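(* Let $\Omega$ be an interpolation data set with Pick matrix $P$ and let $\kappa = \mathrm{sq}_-P$. Suppose that $P$ is singular. Then the Master Boundary Interpolation Problem for $\Omega$ has a unique solution $w$. Furthermore, if $w \in \mathbf{N}_\kappa$, then $w$ is also a solution of the Boundary Interpolation Problem with inequalities for $\Omega$.
   Context: Classes. $\mathbb{C}^+$ is the open upper half plane. For $w$ meromorphic on $\mathbb{C}^+$, $\rho(w)\subset\mathbb{C}^+$ is its domain of analyticity and $K_w(z,\zeta)=\frac{w(z)-\overline{w(\zeta)}}{z-\bar\zeta}$. For an integer $\kappa\ge 0$, $\mathbf{N}_\kappa$ is the set of $w$ meromorphic on $\mathbb{C}^+$ such that all matrices $[K_w(z_j,z_i)]_{i,j=1}^m$ ($m\ge1$, $z_i\in\rho(w)$) have at most $\kappa$ negative eigenvalues, and at least one has exactly $\kappa$. $\mathrm{sq}_-A$ is the number of negative eigenvalues (with multiplicity) of a Hermitian matrix $A$. Boundary limits. For $x\in\mathbb{R}$, $w(x)$, $w'(x)$ and $w_{-1}(x)$ denote the nontangential limits as $z\to x$ of $w(z)$, $w'(z)$ and $(z-x)w(z)$, when they exist; $w_{-1}(x)=\infty$ is allowed, with $1/\infty=0$. Data. $\Omega=\{\{x_i\}_{i=1}^n,\{w_j\}_{j=1}^\ell,\{\gamma_j\}_{j=1}^\ell,\{\xi_k\}_{k=\ell+1}^n\}$, $0\le\ell\le n$, where $x_i$ are distinct real numbers, $w_j,\gamma_j\in\mathbb{R}$, $\xi_k\in\mathbb{R}\setminus\{0\}$. The Pick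 matrix $P=[p_{ij}]_{i,j=1}^n$ is the real symmetric matrix with: $p_{ij}=\frac{w_j-w_i}{x_j-x_i}$ for $i\ne j$ and $p_{ii}=\gamma_i$, for $i,j\le\ell$; $p_{ij}=p_{ji}=\frac{\xi_j}{x_j-x_i}$ for $i\le\ell<j$; $p_{ii}=-\xi_i$ and $p_{ij}=0$ $(i\neq j)$ for $i,j>\ell$. Interpolation conditions with inequalities at $x_i$: for $i\le\ell$: $w(x_i)=w_i$ and $-\infty<w'(x_i)\le\gamma_i$; for $i>\ell$: $-\infty<-\frac1{w_{-1}(x_i)}\le-\frac1{\xi_i}$. Boundary Interpolation Problem with inequalities: find all $w\in\mathbf{N}_\kappa$, $\kappa=\mathrm{sq}_-P$, satisfying these conditions at every $x_1,\dots,x_n$. Master Boundary Interpolation Problem: find all functions $w$ such that $w\in\mathbf{N}_{\kappa'}$ for some $\kappa'\le\kappa=\mathrm{sq}_-P$ and $w$ satisfies these conditions at all but $\kappa-\kappa'$ of the points $x_1,\dots,x_n$. *)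

theory Defs
  imports "HOL-Complex_Analysis.Complex_Analysis" "Jordan_Normal_Form.Char_Poly"
begin

abbreviation upper_half_plane :: "complex set"  (\<open>\<complex>\<^sup>+\<close>) where
  "\<complex>\<^sup>+ \<equiv> {z. Im z > 0}"

(* Number of negative eigenvalues of a Hermitian matrix, counted with multiplicity. *)
definition sq_neg :: "complex mat \<Rightarrow> nat" where
  "sq_neg A = (\<Sum>r | r < 0 \<and> eigenvalue A (complex_of_real r).
                  order (complex_of_real r) (char_poly A))"

definition nevanlinna_kernel :: "(complex \<Rightarrow> complex) \<Rightarrow> complex \<Rightarrow> complex \<Rightarrow> complex" where
  "nevanlinna_kernel w z \<zeta> = (w z - cnj (w \<zeta>)) / (z - cnj \<zeta>)"

definition analyticity_domain :: "(complex \<Rightarrow> complex) \<Rightarrow> complex set" where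
  "analyticity_domain w = {z \<in> \<complex>\<^sup>+. w analytic_on {z}}"

definition kernel_mat :: "(complex \<Rightarrow> complex) \<Rightarrow> nat \<Rightarrow> (nat \<Rightarrow> complex) \<Rightarrow> complex mat" where
  "kernel_mat w m z = Matrix.mat m m (\<lambda>(i, j). nevanlinna_kernel w (z j) (z i))"

(* A meromorphic function on the upper half plane is represented by its normal form: removable
   singularities are removed and the value at every pole is 0.  Hence two such functions are the
   same exactly when they agree at every point of the upper half plane; values elsewhere are
   irrelevant. *)
definition gen_nevanlinna :: "nat \<Rightarrow> (complex \<Rightarrow> complex) set" where
  "gen_nevanlinna \<kappa> = {w. w nicely_meromorphic_on \<complex>\<^sup>+ \<and>
     (\<forall>m\<ge>1. \<forall>z. (\<forall>i<m. z i \<in> analyticity_domain w) \<longrightarrow> sq_neg (kernel_mat w m z) \<le> \<kappa>) \<and>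
     (\<exists>m\<ge>1. \<exists>z. (\<forall>i<m. z i \<in> analyticity_domain w) \<and> sq_neg (kernel_mat w m z) = \<kappa>)}"

definition stolz_angle :: "real \<Rightarrow> real \<Rightarrow> complex set" where
  "stolz_angle x a = {z \<in> \<complex>\<^sup>+. \<bar>Re z - x\<bar> < a * Im z}"

(* f z tends to F as z tends to x nontangentially; F is nhds c for a finite limit c and
   at_infinity for the limit infinity. *)
definition nontangential_limit ::
    "(complex \<Rightarrow> complex) \<Rightarrow> complex filter \<Rightarrow> real \<Rightarrow> bool" where
  "nontangential_limit f F x \<longleftrightarrow>
     (\<forall>a>0. filterlim f F (at (complex_of_real x) within stolz_angle x a))"

(* Interpolation data: n distinct real nodes x i (i < n), of which the first l are regular, with
   values w i and slope bounds \<gamma> i for i < l, and the remaining ones carry \<xi> i for l \<le> i < n.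
   Entries outside these index ranges are not used. *)
definition interpolation_data :: "nat \<Rightarrow> nat \<Rightarrow> (nat \<Rightarrow> real) \<Rightarrow> (nat \<Rightarrow> real) \<Rightarrow> bool" where
  "interpolation_data n l x \<xi> \<longleftrightarrow>
     l \<le> n \<and> inj_on x {..<n} \<and> (\<forall>k. l \<le> k \<and> k < n \<longrightarrow> \<xi> k \<noteq> 0)"

definition pick_mat :: "nat \<Rightarrow> nat \<Rightarrow> (nat \<Rightarrow> real) \<Rightarrow> (nat \<Rightarrow> real) \<Rightarrow> (nat \<Rightarrow> real) \<Rightarrow> (nat \<Rightarrow> real)
    \<Rightarrow> real mat" where
  "pick_mat n l x w \<gamma> \<xi> = Matrix.mat n n (\<lambda>(i, j).
     if i < l \<and> j < l then (if i = j then \<gamma> i else (w j - w i) / (x j - x i))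
     else if i < l then \<xi> j / (x j - x i)
     else if j < l then \<xi> i / (x i - x j)
     else (if i = j then - \<xi> i else 0))"

definition pick_index :: "nat \<Rightarrow> nat \<Rightarrow> (nat \<Rightarrow> real) \<Rightarrow> (nat \<Rightarrow> real) \<Rightarrow> (nat \<Rightarrow> real) \<Rightarrow> (nat \<Rightarrow> real)
    \<Rightarrow> nat" where
  "pick_index n l x w \<gamma> \<xi> = sq_neg (map_mat complex_of_real (pick_mat n l x w \<gamma> \<xi>))"

(* At a singular node the limit of (z - x) f(z) may be infinite, with 1 / infinity = 0; a zero
   limit is excluded by the requirement -infinity < -1 / f_{-1}(x). *)
definition interpolates_at :: "nat \<Rightarrow> (nat \<Rightarrow> real) \<Rightarrow> (nat \<Rightarrow> real) \<Rightarrow> (nat \<Rightarrow> real) \<Rightarrow> (nat \<Rightarrow> real)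
    \<Rightarrow> (complex \<Rightarrow> complex) \<Rightarrow> nat \<Rightarrow> bool" where
  "interpolates_at l x w \<gamma> \<xi> f i \<longleftrightarrow>
     (if i < l then
        nontangential_limit f (nhds (complex_of_real (w i))) (x i) \<and>
        (\<exists>d::real. nontangential_limit (deriv f) (nhds (complex_of_real d)) (x i) \<and> d \<le> \<gamma> i)
      else
        (\<exists>r::real. r \<noteq> 0 \<and>
           nontangential_limit (\<lambda>z. (z - complex_of_real (x i)) * f z)
             (nhds (complex_of_real r)) (x i) \<and>
           - 1 / r \<le> - 1 / \<xi> i) \<or>
        (nontangential_limit (\<lambda>z. (z - complex_of_real (x i)) * f z) at_infinity (x i) \<and>
           0 \<le> - 1 / \<xi> i))"

definition boundary_interpolation_solution :: "nat \<Rightarrow> nat \<Rightarrow> (nat \<Rightarrow> real) \<Rightarrow> (nat \<Rightarrow> real)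
    \<Rightarrow> (nat \<Rightarrow> real) \<Rightarrow> (nat \<Rightarrow> real) \<Rightarrow> (complex \<Rightarrow> complex) \<Rightarrow> bool" where
  "boundary_interpolation_solution n l x w \<gamma> \<xi> f \<longleftrightarrow>
     f \<in> gen_nevanlinna (pick_index n l x w \<gamma> \<xi>) \<and> (\<forall>i<n. interpolates_at l x w \<gamma> \<xi> f i)"

(* E is the set of exceptional nodes, at which nothing is required. *)
definition master_solution :: "nat \<Rightarrow> nat \<Rightarrow> (nat \<Rightarrow> real) \<Rightarrow> (nat \<Rightarrow> real)
    \<Rightarrow> (nat \<Rightarrow> real) \<Rightarrow> (nat \<Rightarrow> real) \<Rightarrow> (complex \<Rightarrow> complex) \<Rightarrow> bool" where
  "master_solution n l x w \<gamma> \<xi> f \<longleftrightarrow>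
     (\<exists>\<kappa>' \<le> pick_index n l x w \<gamma> \<xi>. f \<in> gen_nevanlinna \<kappa>' \<and>
        (\<exists>E \<subseteq> {..<n}. card E = pick_index n l x w \<gamma> \<xi> - \<kappa>' \<and>
           (\<forall>i \<in> {..<n} - E. interpolates_at l x w \<gamma> \<xi> f i)))"

end

theory Submission
  imports Defs "Jordan_Normal_Form.Jordan_Normal_Form_Existence"
begin

text \<open>
  With \<open>X = diag(x\<^sub>i)\<close>, \<open>E\<^sub>i = 1, C\<^sub>i = w\<^sub>i\<close> at regular nodes and \<open>E\<^sub>i = 0, C\<^sub>i = \<xi>\<^sub>i\<close> at singular ones, the
  Pick matrix satisfies the displacement identity \<open>P X - X P = E\<^sup>T C - C\<^sup>T E\<close>.  For \<open>v\<close> in the kernel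
  of \<open>P\<close> put \<open>f = C (z - X)\<^sup>-\<^sup>1 v / E (z - X)\<^sup>-\<^sup>1 v\<close>.  The identity shows that \<open>f\<close> does not depend on \<open>v\<close>
  and that its kernel is \<open>\<Psi>(\<zeta>)\<^sup>* P \<Psi>(z)\<close> with \<open>\<Psi>(z) = (z - X)\<^sup>-\<^sup>1 v / E (z - X)\<^sup>-\<^sup>1 v\<close>.

  Existence: take \<open>v\<close> of minimal support.  The function \<open>f\<close> interpolates at every node of the support,
  and each other node at which it fails yields a vector \<open>g\<close> with \<open>P g\<close> a nonzero multiple of a unit
  vector and \<open>g\<^sup>* P g \<le> 0\<close>.  These vectors, added to a negative subspace coming from the kernel of
  \<open>f\<close>, span a nonpositive subspace that meets the kernel of \<open>P\<close> trivially, so the number of failures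
  plus the index of \<open>f\<close> is at most \<open>sq\<^sub>- P\<close>.

  Uniqueness: for a solution \<open>h\<close>, letting some arguments of its kernel matrix tend to the good nodes
  gives a bordered matrix with at most \<open>\<kappa>'\<close> negative squares, whose corner is at most the corresponding
  block of \<open>P\<close>.  Counting dimensions produces a nonzero \<open>u\<close> in the kernel of \<open>P\<close> with
  \<open>h(z) E (z - X)\<^sup>-\<^sup>1 u = C (z - X)\<^sup>-\<^sup>1 u\<close> at \<open>n\<close> prescribed points \<open>z\<close>, hence \<open>h = f\<close> at one of them.
\<close>

section \<open>Inertia of Hermitian matrices\<close>

text \<open>Gaussian elimination, by induction on the set of equations: a nonzero coefficient of one
  equation serves as pivot, its unknown is eliminated from the other equations and restored at the
  end. Arbitrary index types allow two systems to be joined as a disjoint sum.\<close>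

lemma homogeneous_system_solution:
  fixes b :: "'r \<Rightarrow> 'i \<Rightarrow> 'a::field"
  assumes "finite R" "finite I" "card R < card I"
  shows "\<exists>c. (\<exists>m\<in>I. c m \<noteq> 0) \<and> (\<forall>p\<in>R. (\<Sum>m\<in>I. b p m * c m) = 0)"
  using assms
proof (induction R arbitrary: I b rule: finite_induct)
  case empty
  then obtain m where "m \<in> I" by fastforce
  then show ?case by (intro exI[of _ "\<lambda>_. 1"]) auto
next
  case (insert p R)
  show ?case
  proof (cases "\<forall>m\<in>I. b p m = 0")
    case True
    have "card R < card I" using insert by auto
    from insert.IH[OF insert.prems(1) this, of b] True show ?thesis by auto
  next
    case False
    then obtain m0 where m0: "m0 \<in> I" "b p m0 \<noteq> 0" by auto
    let ?I = "I - {m0}"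
    have "card R < card ?I" using insert m0 by (simp add: card_Diff_singleton)
    from insert.IH[OF _ this, of "\<lambda>q m. b q m - b q m0 * b p m / b p m0"] insert.prems(1)
    obtain c where c: "\<exists>m\<in>?I. c m \<noteq> 0"
      and c0: "\<And>q. q \<in> R \<Longrightarrow> (\<Sum>m\<in>?I. (b q m - b q m0 * b p m / b p m0) * c m) = 0"
      by auto
    define s where "s = (\<Sum>m\<in>?I. b p m * c m)"
    define c' where "c' = c(m0 := - s / b p m0)"
    have split: "(\<Sum>m\<in>I. b q m * c' m) = (\<Sum>m\<in>?I. b q m * c m) - b q m0 * s / b p m0" for q
    proof -
      have "(\<Sum>m\<in>I. b q m * c' m) = b q m0 * c' m0 + (\<Sum>m\<in>?I. b q m * c' m)"
        using m0 insert.prems(1) by (simp add: sum.remove)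
      also have "(\<Sum>m\<in>?I. b q m * c' m) = (\<Sum>m\<in>?I. b q m * c m)"
        by (intro sum.cong) (auto simp: c'_def)
      finally show ?thesis by (simp add: c'_def)
    qed
    have "(\<Sum>m\<in>I. b q m * c' m) = 0" if "q \<in> R" for q
    proof -
      have "(\<Sum>m\<in>?I. (b q m - b q m0 * b p m / b p m0) * c m)
          = (\<Sum>m\<in>?I. b q m * c m) - (\<Sum>m\<in>?I. b q m0 / b p m0 * (b p m * c m))"
        unfolding sum_subtractf[symmetric] by (intro sum.cong) (auto simp: algebra_simps)
      also have "\<dots> = (\<Sum>m\<in>?I. b q m * c m) - b q m0 / b p m0 * s"
        unfolding s_def sum_distrib_left ..
      finally show ?thesis using c0[OF that] split[of q] by simp
    qed
    moreover have "(\<Sum>m\<in>I. b p m * c' m) = 0"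
      unfolding split using m0 by (simp add: s_def)
    moreover have "\<exists>m\<in>I. c' m \<noteq> 0" using c by (auto simp: c'_def)
    ultimately show ?thesis by (intro exI[of _ c']) auto
  qed
qed

text \<open>Off the diagonal a Jordan matrix has entries only on the superdiagonal within a block,
  where the eigenvalue is constant. The induction peels off one block; only index pairs lying in the
  remaining blocks need the induction hypothesis.\<close>

lemma jordan_matrix_bidiagonal:
  assumes "i < sum_list (map fst n_as)" "j < sum_list (map fst n_as)"
    and "jordan_matrix n_as $$ (i, j) \<noteq> (0::'a::field)" "i \<noteq> j"
  shows "j = Suc i \<and> jordan_matrix n_as $$ (i, i) = jordan_matrix n_as $$ (j, j)"
  using assms
proof (induction n_as arbitrary: i j)
  case (Cons na n_as)
  obtain m a where na: "na = (m, a)" by force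
  let ?s = "sum_list (map fst n_as)"
  consider "i < m" "j < m" | "i < m" "j \<ge> m" | "i \<ge> m" "j < m" | "i \<ge> m" "j \<ge> m" by linarith
  then show ?case
  proof cases
    case 4
    with Cons.prems na have "i - m < ?s" "j - m < ?s" "i - m \<noteq> j - m"
      "jordan_matrix n_as $$ (i - m, j - m) \<noteq> 0"
      by (auto simp: jordan_matrix_Cons)
    from Cons.IH[OF this(1,2,4,3)] 4 Cons.prems show ?thesis
      by (auto simp: jordan_matrix_Cons na)
  qed (use Cons.prems na in \<open>auto simp: jordan_matrix_Cons split: if_splits\<close>)
qed simp

text \<open>Vectors and matrices are total functions of which only columns below \<open>n\<close>
  enter, so no carrier conditions arise and rows beyond \<open>n\<close> keep a meaning; the
  bordered matrix of the uniqueness proof uses such rows.\<close>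

definition mvec :: "nat \<Rightarrow> (nat \<Rightarrow> nat \<Rightarrow> complex) \<Rightarrow> (nat \<Rightarrow> complex) \<Rightarrow> nat \<Rightarrow> complex" where
  "mvec n a y i = (\<Sum>j<n. a i j * y j)"

definition herm_form :: "nat \<Rightarrow> (nat \<Rightarrow> nat \<Rightarrow> complex) \<Rightarrow> (nat \<Rightarrow> complex) \<Rightarrow> (nat \<Rightarrow> complex) \<Rightarrow> complex" where
  "herm_form n a x y = (\<Sum>i<n. cnj (x i) * mvec n a y i)"

abbreviation fun_mat :: "nat \<Rightarrow> (nat \<Rightarrow> nat \<Rightarrow> complex) \<Rightarrow> complex mat" where
  "fun_mat n a \<equiv> Matrix.mat n n (\<lambda>(i, j). a i j)"

definition hermitian :: "nat \<Rightarrow> (nat \<Rightarrow> nat \<Rightarrow> complex) \<Rightarrow> bool" where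
  "hermitian n a \<longleftrightarrow> (\<forall>i<n. \<forall>j<n. a j i = cnj (a i j))"

lemma hermitianD: "hermitian n a \<Longrightarrow> i < n \<Longrightarrow> j < n \<Longrightarrow> cnj (a i j) = a j i"
  unfolding hermitian_def by metis

lemma herm_form_adjoint:
  assumes "hermitian n a"
  shows "(\<Sum>i<n. cnj (mvec n a x i) * y i) = herm_form n a x y"
proof -
  have "(\<Sum>i<n. cnj (mvec n a x i) * y i) = (\<Sum>i<n. \<Sum>j<n. cnj (a i j) * cnj (x j) * y i)"
    by (simp add: mvec_def sum_distrib_right)
  also have "\<dots> = (\<Sum>j<n. \<Sum>i<n. cnj (a i j) * cnj (x j) * y i)"
    by (rule sum.swap)
  also have "\<dots> = herm_form n a x y"
    unfolding herm_form_def mvec_def sum_distrib_left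
  proof (intro sum.cong refl)
    fix j i assume "j \<in> {..<n}" "i \<in> {..<n}"
    then show "cnj (a i j) * cnj (x j) * y i = cnj (x j) * (a j i * y i)"
      using hermitianD[OF assms, of i j] by (simp only: lessThan_iff mult_ac)
  qed
  finally show ?thesis .
qed

lemma mvec_cong:
  assumes "\<And>j. j < n \<Longrightarrow> y j = z j"
  shows "mvec n a y i = mvec n a z i"
  unfolding mvec_def using assms by (intro sum.cong) auto

lemma mvec_sum: "mvec n a (\<lambda>i. \<Sum>m\<in>I. Y m i * c m) i = (\<Sum>m\<in>I. mvec n a (Y m) i * c m)"
proof -
  have "mvec n a (\<lambda>i. \<Sum>m\<in>I. Y m i * c m) i = (\<Sum>j<n. \<Sum>m\<in>I. a i j * Y m j * c m)"
    by (simp add: mvec_def sum_distrib_left mult_ac)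
  also have "\<dots> = (\<Sum>m\<in>I. \<Sum>j<n. a i j * Y m j * c m)" by (rule sum.swap)
  finally show ?thesis by (simp add: mvec_def sum_distrib_right)
qed

lemma mvec_add: "mvec n a (\<lambda>j. y j + z j) i = mvec n a y i + mvec n a z i"
  by (simp add: mvec_def algebra_simps sum.distrib)

lemma mvec_diff: "mvec n a (\<lambda>j. y j - z j) i = mvec n a y i - mvec n a z i"
  by (simp add: mvec_def algebra_simps sum_subtractf)

lemma mvec_scale: "mvec n a (\<lambda>j. k * y j) i = k * mvec n a y i"
  by (simp add: mvec_def sum_distrib_left mult_ac)

lemma sum_cnj_self: "(\<Sum>i\<in>I. cnj (x i) * x i) = complex_of_real (\<Sum>i\<in>I. (cmod (x i))\<^sup>2)"
  unfolding of_real_sum complex_norm_square by (simp add: mult.commute)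

text \<open>Pairing a nonzero \<open>x\<close> with its own image shows that \<open>r\<close> is
  real. Moving the matrix across the pairing of \<open>x\<close> with \<open>y\<close> then cancels
  both terms with \<open>r\<close> and leaves the squared norm of \<open>x\<close> equal to
  0.\<close>

lemma hermitian_no_jordan_chain:
  assumes herm: "hermitian n a"
    and q1: "\<And>i. i < n \<Longrightarrow> mvec n a x i = r * x i"
    and q2: "\<And>i. i < n \<Longrightarrow> mvec n a y i = r * y i + x i"
  shows "\<forall>i<n. x i = 0"
proof (rule ccontr)
  assume "\<not> ?thesis"
  then obtain i0 where i0: "i0 < n" "x i0 \<noteq> 0" by auto
  let ?N = "\<Sum>i<n. cnj (x i) * x i"
  have N: "?N = complex_of_real (\<Sum>i<n. (cmod (x i))\<^sup>2)"
    by (rule sum_cnj_self)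
  have "(\<Sum>i<n. (cmod (x i))\<^sup>2) \<noteq> 0"
    using i0 by (subst sum_nonneg_eq_0_iff) auto
  then have N0: "?N \<noteq> 0" unfolding N of_real_eq_0_iff .
  have "r * ?N = herm_form n a x x"
    unfolding herm_form_def sum_distrib_left using q1 by (intro sum.cong) auto
  also have "\<dots> = cnj r * ?N"
    unfolding herm_form_adjoint[OF herm, symmetric] sum_distrib_left
    using q1 by (intro sum.cong) auto
  finally have r: "cnj r = r" using N0 by simp
  have "r * (\<Sum>i<n. cnj (x i) * y i) + ?N = herm_form n a x y"
    unfolding herm_form_def sum_distrib_left sum.distrib[symmetric]
    using q2 by (intro sum.cong) (auto simp: algebra_simps)
  also have "\<dots> = cnj r * (\<Sum>i<n. cnj (x i) * y i)"
    unfolding herm_form_adjoint[OF herm, symmetric] sum_distrib_left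
    using q1 by (intro sum.cong) auto
  finally show False using N0 r by simp
qed

lemma order_prod_linear_factors:
  "order r (\<Prod>a\<leftarrow>as. [:- a, 1:]) = count_list as (r::complex)"
proof (induction as)
  case (Cons b as)
  have ne: "(\<Prod>a\<leftarrow>as. [:- a, 1:]) \<noteq> (0::complex poly)"
    using prod_list_zero_iff by fastforce
  have "order r [:- b, 1:] = (if r = b then 1 else 0)"
    using order_power_n_n[of r 1] by (auto intro: order_0I)
  moreover have "order r ([:- b, 1:] * (\<Prod>a\<leftarrow>as. [:- a, 1:]))
      = order r [:- b, 1:] + order r (\<Prod>a\<leftarrow>as. [:- a, 1:])"
    using ne by (intro order_mult) (auto simp del: mult_pCons_left)
  ultimately show ?case using Cons by (auto simp del: mult_pCons_left)
qed (auto intro: order_0I)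

text \<open>Hermitian symmetry rules out off-diagonal entries in the Jordan form, so
  \<open>p\<close> consists of eigenvectors and \<open>q\<close> of the rows of the inverse matrix.
  The eigenvectors are not made orthonormal: the duality of \<open>p\<close> and \<open>q\<close>,
  together with orthogonality across different eigenvalues, suffices later.\<close>

lemma hermitian_diagonalization:
  assumes herm: "hermitian n a"
  obtains p :: "nat \<Rightarrow> nat \<Rightarrow> complex" and d :: "nat \<Rightarrow> real" and q :: "nat \<Rightarrow> nat \<Rightarrow> complex"
  where "\<And>k i. k < n \<Longrightarrow> i < n \<Longrightarrow> mvec n a (p k) i = d k * p k i"
    and "\<And>i j. i < n \<Longrightarrow> j < n \<Longrightarrow> (\<Sum>k<n. p k i * q k j) = (if i = j then 1 else 0)"
    and "\<And>k m. k < n \<Longrightarrow> m < n \<Longrightarrow> (\<Sum>i<n. q k i * p m i) = (if k = m then 1 else 0)"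
    and "sq_neg (fun_mat n a) = card {k. k < n \<and> d k < 0}"
proof -
  let ?A = "fun_mat n a"
  have A: "?A \<in> carrier_mat n n" by simp
  obtain as where as: "char_poly ?A = (\<Prod>a\<leftarrow>as. [:- a, 1:])"
    using char_poly_factorized[OF A] by auto
  obtain n_as where "jordan_nf ?A n_as" using jordan_nf_exists[OF A as] by auto
  then have sim: "similar_mat ?A (jordan_matrix n_as)" by (simp add: jordan_nf_def)
  define J where "J = jordan_matrix n_as"
  from sim obtain P Q where wit: "similar_mat_wit ?A J P Q"
    unfolding similar_mat_def J_def by auto
  note W = similar_mat_witD2[OF A wit]
  have dimn: "sum_list (map fst n_as) = n" using carrier_matD(1)[OF W(5)] unfolding J_def jordan_matrix_dim .
  have bid: "j = Suc i \<and> J $$ (i, i) = J $$ (j, j)"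
    if "i < n" "j < n" "J $$ (i, j) \<noteq> 0" "i \<noteq> j" for i j
    using jordan_matrix_bidiagonal[of i n_as j] that dimn by (auto simp: J_def)
  define p where "p = (\<lambda>k i. P $$ (i, k))"
  define q where "q = (\<lambda>k i. Q $$ (k, i))"
  have AP: "?A * P = P * J"
  proof -
    have "?A * P = P * J * (Q * P)" using W by (simp add: assoc_mult_mat[of _ n n _ n _ n])
    then show ?thesis using W by simp
  qed
  have col: "mvec n a (p k) i = (\<Sum>j<n. p j i * J $$ (j, k))" if "k < n" "i < n" for k i
  proof -
    have "mvec n a (p k) i = (?A * P) $$ (i, k)"
      using that W(5-7) by (auto simp: mvec_def p_def scalar_prod_def atLeast0LessThan intro!: sum.cong)
    also have "\<dots> = (P * J) $$ (i, k)" by (simp only: AP)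
    also have "\<dots> = (\<Sum>j<n. p j i * J $$ (j, k))"
      using that W(5-7) by (auto simp: p_def scalar_prod_def atLeast0LessThan intro!: sum.cong)
    finally show ?thesis .
  qed
  have pq: "(\<Sum>k<n. p k i * q k j) = (if i = j then 1 else 0)" if "i < n" "j < n" for i j
  proof -
    have "(\<Sum>k<n. p k i * q k j) = (P * Q) $$ (i, j)"
      using that W(4-7) by (auto simp: p_def q_def scalar_prod_def atLeast0LessThan intro!: sum.cong)
    then show ?thesis using that W by simp
  qed
  have qp: "(\<Sum>i<n. q k i * p m i) = (if k = m then 1 else 0)" if "k < n" "m < n" for k m
  proof -
    have "(\<Sum>i<n. q k i * p m i) = (Q * P) $$ (k, m)"
      using that W(4-7) by (auto simp: p_def q_def scalar_prod_def atLeast0LessThan intro!: sum.cong)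
    then show ?thesis using that W by simp
  qed
  have pne: "\<exists>i<n. p k i \<noteq> 0" if "k < n" for k
  proof (rule ccontr)
    assume "\<not> ?thesis"
    then have "(\<Sum>i<n. q k i * p k i) = 0" by (intro sum.neutral) auto
    then show False using qp[OF that that] by simp
  qed
  have diag: "J $$ (i, j) = 0" if ij: "i < n" "j < n" "i \<noteq> j" for i j
  proof (rule ccontr)
    assume "J $$ (i, j) \<noteq> 0"
    then have ex: "\<exists>i. Suc i < n \<and> J $$ (i, Suc i) \<noteq> 0" using bid[OF ij(1,2)] ij by auto
    \<comment> \<open>At the first nonzero superdiagonal position, column \<open>m\<close> still has
      only its diagonal entry, so \<open>p m\<close> is an eigenvector, and column
      \<open>Suc m\<close> completes a chain of length two after scaling by
      \<open>s\<close>.\<close>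
    define m where "m = (LEAST i. Suc i < n \<and> J $$ (i, Suc i) \<noteq> 0)"
    have m: "Suc m < n" "J $$ (m, Suc m) \<noteq> 0" using LeastI_ex[OF ex] by (auto simp: m_def)
    have mmin: "J $$ (i, Suc i) = 0" if "i < m" for i
      using not_less_Least[of i "\<lambda>i. Suc i < n \<and> J $$ (i, Suc i) \<noteq> 0"] that m(1)
      by (auto simp: m_def)
    define r where "r = J $$ (m, m)"
    define s where "s = J $$ (m, Suc m)"
    have r: "J $$ (Suc m, Suc m) = r" using bid[of m "Suc m"] m by (auto simp: r_def)
    have c1: "J $$ (i, m) = (if i = m then r else 0)" if "i < n" for i
      using bid[of i m] mmin[of i] that m by (auto simp: r_def)
    have c2: "J $$ (i, Suc m) = (if i = m then s else if i = Suc m then r else 0)"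
      if "i < n" for i
      using bid[of i "Suc m"] that m r by (auto simp: s_def)
    have "\<forall>i<n. s * p m i = 0"
    proof (rule hermitian_no_jordan_chain[OF herm])
      fix i assume i: "i < n"
      have "mvec n a (p m) i = (\<Sum>j<n. if j = m then r * p m i else 0)"
        unfolding col[OF Suc_lessD[OF m(1)] i] by (intro sum.cong) (auto simp: c1)
      then show "mvec n a (\<lambda>i. s * p m i) i = r * (s * p m i)"
        using m by (simp add: mvec_scale)
      have "mvec n a (p (Suc m)) i = (\<Sum>j<n. (if j = Suc m then r * p (Suc m) i else 0)
            + (if j = m then s * p m i else 0))"
        unfolding col[OF m(1) i] by (intro sum.cong) (auto simp: c2)
      then show "mvec n a (p (Suc m)) i = r * p (Suc m) i + s * p m i"
        using m by (simp add: sum.distrib)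
    qed
    then show False using pne[of m] m by (auto simp: s_def)
  qed
  have eig: "mvec n a (p k) i = J $$ (k, k) * p k i" if "k < n" "i < n" for k i
  proof -
    have "mvec n a (p k) i = (\<Sum>j<n. if j = k then J $$ (k, k) * p k i else 0)"
      unfolding col[OF that] using that by (intro sum.cong) (auto simp: diag)
    then show ?thesis using that by simp
  qed
  have real: "J $$ (k, k) = complex_of_real (Re (J $$ (k, k)))" if k: "k < n" for k
  proof -
    let ?N = "\<Sum>i<n. cnj (p k i) * p k i"
    have N: "?N = complex_of_real (\<Sum>i<n. (cmod (p k i))\<^sup>2)"
      by (rule sum_cnj_self)
    have "(\<Sum>i<n. (cmod (p k i))\<^sup>2) \<noteq> 0"
      using pne[OF k] by (subst sum_nonneg_eq_0_iff) auto
    then have N0: "?N \<noteq> 0" unfolding N of_real_eq_0_iff .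
    have "J $$ (k, k) * ?N = herm_form n a (p k) (p k)"
      unfolding herm_form_def sum_distrib_left using eig[OF k] by (intro sum.cong) auto
    also have "\<dots> = cnj (J $$ (k, k)) * ?N"
      unfolding herm_form_adjoint[OF herm, symmetric] sum_distrib_left
      using eig[OF k] by (intro sum.cong) auto
    finally have "cnj (J $$ (k, k)) = J $$ (k, k)" using N0 by simp
    then show ?thesis by (simp add: complex_eq_iff)
  qed
  define d where "d = (\<lambda>k. Re (J $$ (k, k)))"
  have ut: "upper_triangular J"
    unfolding upper_triangular_def using W(5) diag by auto
  have dJ: "diag_mat J = map (\<lambda>k. complex_of_real (d k)) [0..<n]"
    unfolding diag_mat_def d_def using carrier_matD(1)[OF W(5)] real by (intro map_cong) auto
  have cp: "char_poly ?A = (\<Prod>a\<leftarrow>diag_mat J. [:- a, 1:])"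
    using char_poly_similar[OF sim] char_poly_upper_triangular[OF W(5) ut] by (simp add: J_def)
  \<comment> \<open>The characteristic polynomial splits along the diagonal of \<open>J\<close>, so
    algebraic multiplicities become cardinalities and the sum defining \<open>sq_neg\<close> becomes
    a disjoint union.\<close>
  have ord: "order (complex_of_real r) (char_poly ?A) = card {k. k < n \<and> d k = r}" for r
  proof -
    have "order (complex_of_real r) (char_poly ?A) = length (filter (\<lambda>k. d k = r) [0..<n])"
      unfolding cp order_prod_linear_factors dJ count_list_eq_length_filter
      by (auto simp: filter_map o_def intro!: arg_cong[of _ _ length] filter_cong)
    also have "\<dots> = card {k. k < n \<and> d k = r}"
      unfolding length_filter_conv_card by (rule arg_cong[of _ _ card]) auto
    finally show ?thesis .
  qed
  have ev: "eigenvalue ?A (complex_of_real r) \<longleftrightarrow> r \<in> d ` {..<n}" for r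
    unfolding eigenvalue_root_char_poly[OF A] cp dJ
    by (auto simp: poly_prod_list o_def prod_list_zero_iff)
  have "sq_neg ?A = (\<Sum>r\<in>{r \<in> d ` {..<n}. r < 0}. card {k. k < n \<and> d k = r})"
    unfolding sq_neg_def ord ev by (intro sum.cong) auto
  also have "\<dots> = card (\<Union>r\<in>{r \<in> d ` {..<n}. r < 0}. {k. k < n \<and> d k = r})"
    by (rule card_UN_disjoint[symmetric]) (simp_all, blast)
  also have "(\<Union>r\<in>{r \<in> d ` {..<n}. r < 0}. {k. k < n \<and> d k = r}) = {k. k < n \<and> d k < 0}"
    by auto
  finally have sq: "sq_neg ?A = card {k. k < n \<and> d k < 0}" .
  have eig': "mvec n a (p k) i = complex_of_real (d k) * p k i" if "k < n" "i < n" for k i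
    using eig[OF that] real[OF that(1)] unfolding d_def by metis
  show thesis using eig' pq qp sq by (rule that)
qed

text \<open>Here \<open>s\<close> is the common sign of the eigenvalues in \<open>K\<close>.
  Eigenvectors of different eigenvalues are orthogonal, and for equal eigenvalues the two
  square-root weights multiply to \<bar>d k\<bar>; hence the form is \<open>s\<close> times one
  squared norm although the family is not orthonormal.\<close>

lemma herm_form_eigen_sum:
  assumes herm: "hermitian n a" and K: "finite K"
    and eig: "\<And>k i. k \<in> K \<Longrightarrow> i < n \<Longrightarrow> mvec n a (p k) i = complex_of_real (d k) * p k i"
    and s: "\<And>k. k \<in> K \<Longrightarrow> s * \<bar>d k\<bar> = d k"
    and y: "\<And>i. i < n \<Longrightarrow> y i = (\<Sum>k\<in>K. p k i * \<eta> k)"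
  shows "herm_form n a y y
    = complex_of_real (s * (\<Sum>i<n. (cmod (\<Sum>k\<in>K. p k i * (complex_of_real (sqrt \<bar>d k\<bar>) * \<eta> k)))\<^sup>2))"
proof -
  define g where "g = (\<lambda>k m. \<Sum>i<n. cnj (p k i) * p m i)"
  have orth: "complex_of_real (d m) * g k m
      = complex_of_real (s * (sqrt \<bar>d k\<bar> * sqrt \<bar>d m\<bar>)) * g k m" if "k \<in> K" "m \<in> K" for k m
  proof (cases "d k = d m")
    case True
    then show ?thesis using s[OF that(2)] by simp
  next
    case False
    have "complex_of_real (d m) * g k m = herm_form n a (p k) (p m)"
      unfolding herm_form_def g_def sum_distrib_left using eig[OF that(2)] by (intro sum.cong) auto
    also have "\<dots> = complex_of_real (d k) * g k m"
      unfolding herm_form_adjoint[OF herm, symmetric] g_def sum_distrib_left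
      using eig[OF that(1)] by (intro sum.cong) auto
    finally have "g k m = 0" using False by simp
    then show ?thesis by simp
  qed
  have double: "(\<Sum>i<n. cnj (\<Sum>k\<in>K. p k i * e k) * (\<Sum>m\<in>K. p m i * f m))
      = (\<Sum>k\<in>K. \<Sum>m\<in>K. cnj (e k) * f m * g k m)" for e f
  proof -
    have "(\<Sum>i<n. cnj (\<Sum>k\<in>K. p k i * e k) * (\<Sum>m\<in>K. p m i * f m))
        = (\<Sum>i<n. \<Sum>k\<in>K. \<Sum>m\<in>K. cnj (e k) * f m * (cnj (p k i) * p m i))"
      unfolding cnj_sum sum_product by (intro sum.cong refl) (simp add: mult_ac)
    also have "\<dots> = (\<Sum>k\<in>K. \<Sum>i<n. \<Sum>m\<in>K. cnj (e k) * f m * (cnj (p k i) * p m i))"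
      by (rule sum.swap)
    also have "\<dots> = (\<Sum>k\<in>K. \<Sum>m\<in>K. \<Sum>i<n. cnj (e k) * f m * (cnj (p k i) * p m i))"
      by (intro sum.cong refl sum.swap)
    finally show ?thesis by (simp add: g_def sum_distrib_left)
  qed
  have my: "mvec n a y i = (\<Sum>m\<in>K. p m i * (complex_of_real (d m) * \<eta> m))" if "i < n" for i
  proof -
    have "mvec n a y i = mvec n a (\<lambda>i. \<Sum>k\<in>K. p k i * \<eta> k) i" using y by (rule mvec_cong)
    also have "\<dots> = (\<Sum>m\<in>K. p m i * (complex_of_real (d m) * \<eta> m))"
      unfolding mvec_sum using eig that by (intro sum.cong) auto
    finally show ?thesis .
  qed
  have "herm_form n a y y = (\<Sum>i<n. cnj (\<Sum>k\<in>K. p k i * \<eta> k)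
      * (\<Sum>m\<in>K. p m i * (complex_of_real (d m) * \<eta> m)))"
    unfolding herm_form_def using y my by (intro sum.cong) auto
  also have "\<dots> = (\<Sum>k\<in>K. \<Sum>m\<in>K. cnj (\<eta> k) * \<eta> m * (complex_of_real (d m) * g k m))"
    unfolding double by (simp add: mult_ac)
  also have "\<dots> = (\<Sum>k\<in>K. \<Sum>m\<in>K. cnj (\<eta> k) * \<eta> m
      * (complex_of_real (s * (sqrt \<bar>d k\<bar> * sqrt \<bar>d m\<bar>)) * g k m))"
    using orth by (intro sum.cong refl) auto
  also have "\<dots> = complex_of_real s * (\<Sum>k\<in>K. \<Sum>m\<in>K. cnj (complex_of_real (sqrt \<bar>d k\<bar>) * \<eta> k)
      * (complex_of_real (sqrt \<bar>d m\<bar>) * \<eta> m) * g k m)"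
    by (simp add: sum_distrib_left mult_ac)
  also have "\<dots> = complex_of_real s * complex_of_real
      (\<Sum>i<n. (cmod (\<Sum>k\<in>K. p k i * (complex_of_real (sqrt \<bar>d k\<bar>) * \<eta> k)))\<^sup>2)"
    unfolding double[symmetric] by (simp only: sum_cnj_self)
  finally show ?thesis by (simp only: of_real_mult)
qed

section \<open>Counting negative squares with families of vectors\<close>

lemma dual_basis_coefficient:
  fixes p q :: "nat \<Rightarrow> nat \<Rightarrow> complex"
  assumes "K \<subseteq> {..<n}" "k < n"
    and "\<And>k m. k < n \<Longrightarrow> m < n \<Longrightarrow> (\<Sum>i<n. q k i * p m i) = (if k = m then 1 else 0)"
  shows "(\<Sum>i<n. q k i * (\<Sum>m\<in>K. p m i * e m)) = (if k \<in> K then e k else 0)"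
proof -
  have fin: "finite K" by (rule finite_subset[OF assms(1)]) simp
  have "(\<Sum>i<n. q k i * (\<Sum>m\<in>K. p m i * e m)) = (\<Sum>i<n. \<Sum>m\<in>K. q k i * p m i * e m)"
    by (simp add: sum_distrib_left mult_ac)
  also have "\<dots> = (\<Sum>m\<in>K. (\<Sum>i<n. q k i * p m i) * e m)"
    by (subst sum.swap) (simp add: sum_distrib_right)
  also have "\<dots> = (\<Sum>m\<in>K. if k = m then e m else 0)"
    using assms by (intro sum.cong) auto
  finally show ?thesis using fin by simp
qed

text \<open>A dimension count: too large a family has a nontrivial combination that obeys the
  equations \<open>R\<close> and has no component along negative eigenvectors. Its form is then
  nonnegative, so nonpositivity makes it 0 and puts the combination in the kernel. Requiring a
  nonzero image thus replaces strict negativity, and linear independence of \<open>Y\<close> never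
  has to be stated.\<close>

lemma card_le_sq_neg:
  fixes Y :: "'i \<Rightarrow> nat \<Rightarrow> complex" and b :: "'r \<Rightarrow> 'i \<Rightarrow> complex"
  assumes herm: "hermitian n a" and I: "finite I" and R: "finite R"
    and nonpos: "\<And>c y. \<exists>m\<in>I. c m \<noteq> 0 \<Longrightarrow> \<forall>r\<in>R. (\<Sum>m\<in>I. b r m * c m) = 0
        \<Longrightarrow> (\<And>i. y i = (\<Sum>m\<in>I. Y m i * c m))
        \<Longrightarrow> Re (herm_form n a y y) \<le> 0 \<and> (\<exists>i<n. mvec n a y i \<noteq> 0)"
  shows "card I \<le> card R + sq_neg (fun_mat n a)"
proof (rule ccontr)
  assume less: "\<not> ?thesis"
  obtain p d q where
    eig: "\<And>k i. k < n \<Longrightarrow> i < n \<Longrightarrow> mvec n a (p k) i = complex_of_real (d k) * p k i"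
    and pq: "\<And>i j. i < n \<Longrightarrow> j < n \<Longrightarrow> (\<Sum>k<n. p k i * q k j) = (if i = j then 1 else 0)"
    and qp: "\<And>k m. k < n \<Longrightarrow> m < n \<Longrightarrow> (\<Sum>i<n. q k i * p m i) = (if k = m then 1 else 0)"
    and sq: "sq_neg (fun_mat n a) = card {k. k < n \<and> d k < 0}"
    by (rule hermitian_diagonalization[OF herm]) (rule that, assumption+)
  let ?N = "{k. k < n \<and> d k < 0}" and ?K = "{k. k < n \<and> d k \<ge> 0}"
  \<comment> \<open>The left summand carries the given equations, the right one demands that the
    coefficient along each negative eigenvector vanish.\<close>
  let ?b = "\<lambda>r m. case r of Inl r \<Rightarrow> b r m | Inr k \<Rightarrow> (\<Sum>i<n. q k i * Y m i)"
  have "card (R <+> ?N) < card I" using less R by (simp add: card_Plus sq)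
  from homogeneous_system_solution[OF _ I this, of ?b] R
  obtain c where c: "\<exists>m\<in>I. c m \<noteq> 0"
    and eqs: "\<And>r. r \<in> R <+> ?N \<Longrightarrow> (\<Sum>m\<in>I. ?b r m * c m) = 0" by auto
  define y where "y = (\<lambda>i. \<Sum>m\<in>I. Y m i * c m)"
  define \<eta> where "\<eta> = (\<lambda>k. \<Sum>i<n. q k i * y i)"
  have "\<forall>r\<in>R. (\<Sum>m\<in>I. b r m * c m) = 0" using eqs[OF InlI] by auto
  then have le: "Re (herm_form n a y y) \<le> 0" and ex: "\<exists>i<n. mvec n a y i \<noteq> 0"
    using nonpos[OF c, of y] by (auto simp: y_def)
  have \<eta>0: "\<eta> k = 0" if "k \<in> ?N" for k
  proof -
    have "\<eta> k = (\<Sum>i<n. \<Sum>m\<in>I. q k i * Y m i * c m)"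
      by (simp add: \<eta>_def y_def sum_distrib_left mult_ac)
    also have "\<dots> = (\<Sum>m\<in>I. (\<Sum>i<n. q k i * Y m i) * c m)"
      by (subst sum.swap) (simp add: sum_distrib_right)
    also have "\<dots> = 0" using eqs[OF InrI[OF that]] by simp
    finally show ?thesis .
  qed
  have yK: "y i = (\<Sum>k\<in>?K. p k i * \<eta> k)" if i: "i < n" for i
  proof -
    have "(\<Sum>k<n. p k i * \<eta> k) = (\<Sum>k<n. \<Sum>j<n. p k i * q k j * y j)"
      by (simp add: \<eta>_def sum_distrib_left mult_ac)
    also have "\<dots> = (\<Sum>j<n. (\<Sum>k<n. p k i * q k j) * y j)"
      by (subst sum.swap) (simp add: sum_distrib_right)
    also have "\<dots> = (\<Sum>j<n. if i = j then y j else 0)"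
      using pq i by (intro sum.cong) auto
    also have "\<dots> = y i" using i by simp
    finally have "y i = (\<Sum>k<n. p k i * \<eta> k)" ..
    also have "\<dots> = (\<Sum>k\<in>?K. p k i * \<eta> k)"
      using \<eta>0 by (intro sum.mono_neutral_right) (auto simp: not_le)
    finally show ?thesis .
  qed
  define z where "z = (\<lambda>i. \<Sum>k\<in>?K. p k i * (complex_of_real (sqrt \<bar>d k\<bar>) * \<eta> k))"
  have "herm_form n a y y = complex_of_real (1 * (\<Sum>i<n. (cmod (z i))\<^sup>2))"
    unfolding z_def by (rule herm_form_eigen_sum[OF herm _ eig _ yK]) auto
  then have "(\<Sum>i<n. (cmod (z i))\<^sup>2) \<le> 0" using le by simp
  then have "(\<Sum>i<n. (cmod (z i))\<^sup>2) = 0" by (simp add: order_antisym sum_nonneg)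
  then have z0: "z i = 0" if "i < n" for i
    using that by (subst (asm) sum_nonneg_eq_0_iff) auto
  have d\<eta>: "complex_of_real (d k) * \<eta> k = 0" if k: "k \<in> ?K" for k
  proof -
    have "(\<Sum>i<n. q k i * z i) = complex_of_real (sqrt \<bar>d k\<bar>) * \<eta> k"
      unfolding z_def using k by (subst dual_basis_coefficient[OF _ _ qp]) auto
    moreover have "(\<Sum>i<n. q k i * z i) = 0" using z0 by simp
    ultimately show ?thesis by simp
  qed
  have "mvec n a y i = 0" if i: "i < n" for i
  proof -
    have "mvec n a y i = mvec n a (\<lambda>i. \<Sum>k\<in>?K. p k i * \<eta> k) i" using yK by (rule mvec_cong)
    also have "\<dots> = (\<Sum>k\<in>?K. p k i * (complex_of_real (d k) * \<eta> k))"
      unfolding mvec_sum using eig i by (intro sum.cong) auto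
    also have "\<dots> = 0" using d\<eta> by (intro sum.neutral) auto
    finally show ?thesis .
  qed
  then show False using ex by auto
qed

text \<open>The eigenvectors of negative eigenvalues realise the count. The uniform margin \<delta>,
  measured in the coefficients \<open>c\<close>, lets negativity survive small perturbations and
  shows that a vanishing form forces vanishing coefficients.\<close>

lemma sq_neg_negative_family:
  assumes herm: "hermitian n a"
  obtains I :: "nat set" and p :: "nat \<Rightarrow> nat \<Rightarrow> complex" and \<delta> :: real
  where "finite I" "card I = sq_neg (fun_mat n a)" "\<delta> > 0"
    and "\<And>c y. (\<And>i. i < n \<Longrightarrow> y i = (\<Sum>m\<in>I. p m i * c m)) \<Longrightarrow>
      Re (herm_form n a y y) \<le> - \<delta> * (\<Sum>m\<in>I. (cmod (c m))\<^sup>2)"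
proof -
  obtain p d q where
    eig: "\<And>k i. k < n \<Longrightarrow> i < n \<Longrightarrow> mvec n a (p k) i = complex_of_real (d k) * p k i"
    and pq: "\<And>i j. i < n \<Longrightarrow> j < n \<Longrightarrow> (\<Sum>k<n. p k i * q k j) = (if i = j then 1 else 0)"
    and qp: "\<And>k m. k < n \<Longrightarrow> m < n \<Longrightarrow> (\<Sum>i<n. q k i * p m i) = (if k = m then 1 else 0)"
    and sq: "sq_neg (fun_mat n a) = card {k. k < n \<and> d k < 0}"
    by (rule hermitian_diagonalization[OF herm]) (rule that, assumption+)
  let ?I = "{k. k < n \<and> d k < 0}"
  \<comment> \<open>The coefficient \<open>c k\<close> is recovered from the weighted vector
    \<open>z\<close> by the dual row \<open>q k\<close>, so its square is at most \<open>M k\<close>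
    times the squared norm \<open>T\<close>. The summand 1 in the next definition keeps the
    denominator positive when there are no negative eigenvalues.\<close>
  define M where "M = (\<lambda>k. (\<Sum>i<n. cmod (q k i))\<^sup>2 / \<bar>d k\<bar>)"
  define \<delta> where "\<delta> = 1 / (1 + (\<Sum>k\<in>?I. M k))"
  have M0: "M k \<ge> 0" for k by (simp add: M_def)
  have \<delta>: "\<delta> > 0" unfolding \<delta>_def using M0 by (simp add: add_pos_nonneg sum_nonneg)
  have "Re (herm_form n a y y) \<le> - \<delta> * (\<Sum>m\<in>?I. (cmod (c m))\<^sup>2)"
    if y: "\<And>i. i < n \<Longrightarrow> y i = (\<Sum>m\<in>?I. p m i * c m)" for c y
  proof -
    define z where "z = (\<lambda>i. \<Sum>k\<in>?I. p k i * (complex_of_real (sqrt \<bar>d k\<bar>) * c k))"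
    define T where "T = (\<Sum>i<n. (cmod (z i))\<^sup>2)"
    have T0: "T \<ge> 0" unfolding T_def by (simp add: sum_nonneg)
    have "herm_form n a y y = complex_of_real ((-1) * (\<Sum>i<n. (cmod (z i))\<^sup>2))"
      unfolding z_def by (rule herm_form_eigen_sum[OF herm _ eig _ y]) auto
    then have form: "Re (herm_form n a y y) = - T" by (simp add: T_def)
    have zT: "cmod (z i) \<le> sqrt T" if "i < n" for i
    proof -
      have "(cmod (z i))\<^sup>2 \<le> T" unfolding T_def using that by (intro member_le_sum) auto
      then show ?thesis by (rule real_le_rsqrt)
    qed
    have "(cmod (c k))\<^sup>2 \<le> M k * T" if k: "k \<in> ?I" for k
    proof -
      have "complex_of_real (sqrt \<bar>d k\<bar>) * c k = (\<Sum>i<n. q k i * z i)"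
        unfolding z_def using k by (subst dual_basis_coefficient[OF _ _ qp]) auto
      then have "sqrt \<bar>d k\<bar> * cmod (c k) = cmod (\<Sum>i<n. q k i * z i)"
        by (metis norm_mult norm_of_real abs_of_nonneg real_sqrt_ge_zero abs_ge_zero)
      also have "\<dots> \<le> (\<Sum>i<n. cmod (q k i) * sqrt T)"
        by (rule order_trans[OF norm_sum]) (auto simp: norm_mult intro!: sum_mono mult_left_mono zT)
      also have "\<dots> = (\<Sum>i<n. cmod (q k i)) * sqrt T" by (simp add: sum_distrib_right)
      finally have "(sqrt \<bar>d k\<bar> * cmod (c k))\<^sup>2 \<le> ((\<Sum>i<n. cmod (q k i)) * sqrt T)\<^sup>2"
        by (intro power_mono) auto
      then have "\<bar>d k\<bar> * (cmod (c k))\<^sup>2 \<le> (\<Sum>i<n. cmod (q k i))\<^sup>2 * T"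
        using T0 by (simp add: power_mult_distrib)
      then show ?thesis using k by (simp add: M_def field_simps)
    qed
    then have "(\<Sum>k\<in>?I. (cmod (c k))\<^sup>2) \<le> (\<Sum>k\<in>?I. M k) * T"
      unfolding sum_distrib_right by (intro sum_mono) auto
    also have "\<dots> \<le> (1 + (\<Sum>k\<in>?I. M k)) * T" using T0 by (simp add: algebra_simps)
    also have "\<dots> = T / \<delta>" by (simp add: \<delta>_def)
    finally show ?thesis using \<delta> form by (simp add: field_simps)
  qed
  then show thesis using that[of ?I \<delta> p] sq \<delta> by auto
qed

text \<open>Null eigenvectors are included here, so a singular matrix yields at least one vector
  more than its number of negative squares. This surplus is what makes the dimension count for
  uniqueness strict.\<close>

lemma sq_neg_nonpositive_family:
  assumes herm: "hermitian n a"
  obtains I :: "nat set" and p :: "nat \<Rightarrow> nat \<Rightarrow> complex"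
  where "finite I" "card I \<ge> sq_neg (fun_mat n a)"
    and "\<And>x. \<exists>i<n. x i \<noteq> 0 \<Longrightarrow> \<forall>i<n. mvec n a x i = 0 \<Longrightarrow> card I > sq_neg (fun_mat n a)"
    and "\<And>c y. (\<And>i. i < n \<Longrightarrow> y i = (\<Sum>m\<in>I. p m i * c m)) \<Longrightarrow>
      Re (herm_form n a y y) \<le> 0 \<and>
      (Re (herm_form n a y y) = 0 \<longrightarrow> (\<forall>i<n. mvec n a y i = 0)) \<and>
      ((\<exists>m\<in>I. c m \<noteq> 0) \<longrightarrow> (\<exists>i<n. y i \<noteq> 0))"
proof -
  obtain p d q where
    eig: "\<And>k i. k < n \<Longrightarrow> i < n \<Longrightarrow> mvec n a (p k) i = complex_of_real (d k) * p k i"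
    and pq: "\<And>i j. i < n \<Longrightarrow> j < n \<Longrightarrow> (\<Sum>k<n. p k i * q k j) = (if i = j then 1 else 0)"
    and qp: "\<And>k m. k < n \<Longrightarrow> m < n \<Longrightarrow> (\<Sum>i<n. q k i * p m i) = (if k = m then 1 else 0)"
    and sq: "sq_neg (fun_mat n a) = card {k. k < n \<and> d k < 0}"
    by (rule hermitian_diagonalization[OF herm]) (rule that, assumption+)
  let ?I = "{k. k < n \<and> d k \<le> 0}"
  have 1: "card ?I \<ge> sq_neg (fun_mat n a)" unfolding sq by (intro card_mono) auto
  have 2: "card ?I > sq_neg (fun_mat n a)"
    if x: "\<exists>i<n. x i \<noteq> 0" and x0: "\<forall>i<n. mvec n a x i = 0" for x
  proof -
    have "\<exists>k<n. d k = 0"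
    proof (rule ccontr)
      assume nz: "\<not> ?thesis"
      define \<eta> where "\<eta> = (\<lambda>k. \<Sum>i<n. q k i * x i)"
      have xp: "x i = (\<Sum>k<n. p k i * \<eta> k)" if i: "i < n" for i
      proof -
        have "(\<Sum>k<n. p k i * \<eta> k) = (\<Sum>k<n. \<Sum>j<n. p k i * q k j * x j)"
          by (simp add: \<eta>_def sum_distrib_left mult_ac)
        also have "\<dots> = (\<Sum>j<n. (\<Sum>k<n. p k i * q k j) * x j)"
          by (subst sum.swap) (simp add: sum_distrib_right)
        also have "\<dots> = (\<Sum>j<n. if i = j then x j else 0)"
          using pq i by (intro sum.cong) auto
        finally show ?thesis using i by simp
      qed
      have mx: "(\<Sum>m<n. p m i * (complex_of_real (d m) * \<eta> m)) = 0" if i: "i < n" for i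
      proof -
        have "mvec n a x i = mvec n a (\<lambda>i. \<Sum>k<n. p k i * \<eta> k) i" using xp by (rule mvec_cong)
        also have "\<dots> = (\<Sum>m<n. p m i * (complex_of_real (d m) * \<eta> m))"
          unfolding mvec_sum using eig i by (intro sum.cong) auto
        finally show ?thesis using x0 i by simp
      qed
      have "complex_of_real (d k) * \<eta> k = 0" if "k < n" for k
      proof -
        have "complex_of_real (d k) * \<eta> k
            = (\<Sum>i<n. q k i * (\<Sum>m<n. p m i * (complex_of_real (d m) * \<eta> m)))"
          using that by (subst dual_basis_coefficient[OF _ _ qp]) auto
        then show ?thesis using mx by simp
      qed
      then have "\<eta> k = 0" if "k < n" for k using nz that by auto
      then show False using x xp by auto
    qed
    then obtain k where "k < n" "d k = 0" by blast
    then have "k \<in> ?I - {k. k < n \<and> d k < 0}" by simp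
    moreover have "{k. k < n \<and> d k < 0} \<subseteq> ?I" by auto
    ultimately have "{k. k < n \<and> d k < 0} \<subset> ?I" by blast
    then show ?thesis unfolding sq by (intro psubset_card_mono) simp_all
  qed
  have 3: "Re (herm_form n a y y) \<le> 0 \<and>
      (Re (herm_form n a y y) = 0 \<longrightarrow> (\<forall>i<n. mvec n a y i = 0)) \<and>
      ((\<exists>m\<in>?I. c m \<noteq> 0) \<longrightarrow> (\<exists>i<n. y i \<noteq> 0))"
    if y: "\<And>i. i < n \<Longrightarrow> y i = (\<Sum>m\<in>?I. p m i * c m)" for c y
  proof -
    define z where "z = (\<lambda>i. \<Sum>k\<in>?I. p k i * (complex_of_real (sqrt \<bar>d k\<bar>) * c k))"
    define T where "T = (\<Sum>i<n. (cmod (z i))\<^sup>2)"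
    have T0: "T \<ge> 0" unfolding T_def by (simp add: sum_nonneg)
    have "herm_form n a y y = complex_of_real ((-1) * (\<Sum>i<n. (cmod (z i))\<^sup>2))"
      unfolding z_def by (rule herm_form_eigen_sum[OF herm _ eig _ y]) auto
    then have form: "Re (herm_form n a y y) = - T" by (simp add: T_def)
    have "mvec n a y i = 0" if T: "T = 0" and i: "i < n" for i
    proof -
      have z0: "z i = 0" if "i < n" for i
        using T that unfolding T_def by (subst (asm) sum_nonneg_eq_0_iff) auto
      have d\<eta>: "complex_of_real (d k) * c k = 0" if k: "k \<in> ?I" for k
      proof -
        have "(\<Sum>i<n. q k i * z i) = complex_of_real (sqrt \<bar>d k\<bar>) * c k"
          unfolding z_def using k by (subst dual_basis_coefficient[OF _ _ qp]) auto
        moreover have "(\<Sum>i<n. q k i * z i) = 0" using z0 by simp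
        ultimately show ?thesis by simp
      qed
      have "mvec n a y i = mvec n a (\<lambda>i. \<Sum>k\<in>?I. p k i * c k) i" using y by (rule mvec_cong)
      also have "\<dots> = (\<Sum>k\<in>?I. p k i * (complex_of_real (d k) * c k))"
        unfolding mvec_sum using eig i by (intro sum.cong) auto
      also have "\<dots> = 0" using d\<eta> by (intro sum.neutral) auto
      finally show ?thesis .
    qed
    moreover have "\<exists>i<n. y i \<noteq> 0" if k: "k \<in> ?I" "c k \<noteq> 0" for k
    proof (rule ccontr)
      assume "\<not> ?thesis"
      then have "(\<Sum>i<n. q k i * (\<Sum>m\<in>?I. p m i * c m)) = 0"
        using y by (intro sum.neutral) auto
      then show False using k by (subst (asm) dual_basis_coefficient[OF _ _ qp]) auto
    qed
    ultimately show ?thesis using form T0 by auto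
  qed
  show thesis using that[of ?I p] 1 2 3 by auto
qed

section \<open>The displacement structure of the Pick matrix\<close>

text \<open>Over the common denominator the numerator \<open>p\<close> has degree below
  \<open>n\<close> but at least \<open>n\<close> roots, so it is the zero polynomial. Its value at
  \<open>x j\<close> isolates \<open>b j\<close>, since every other \<open>q i\<close> vanishes
  there.\<close>

lemma partial_fractions_zero:
  fixes b x :: "nat \<Rightarrow> complex"
  assumes inj: "inj_on x {..<n}" and Z: "finite Z" "card Z \<ge> n"
    and nodes: "\<And>z j. z \<in> Z \<Longrightarrow> j < n \<Longrightarrow> z \<noteq> x j"
    and zero: "\<And>z. z \<in> Z \<Longrightarrow> (\<Sum>j<n. b j / (z - x j)) = 0"
    and j: "j < n"
  shows "b j = 0"
proof -
  define q where "q = (\<lambda>j. \<Prod>k\<in>{..<n} - {j}. [:- x k, 1:])"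
  define p where "p = (\<Sum>j<n. Polynomial.smult (b j) (q j))"
  have poly_q: "poly (q j) z = (\<Prod>k\<in>{..<n} - {j}. z - x k)" for j z
    by (simp add: q_def poly_prod)
  have "degree (q j) = (\<Sum>k\<in>{..<n} - {j}. degree [:- x k, 1:])" for j
    unfolding q_def by (rule degree_prod_eq_sum_degree) auto
  then have "degree (q j) = n - 1" if "j < n" for j using that by simp
  then have "degree p \<le> n - 1" unfolding p_def
    by (intro degree_sum_le) (auto intro: order_trans[OF degree_smult_le])
  then have deg: "degree p < n" using j by simp
  have root: "poly p z = 0" if z: "z \<in> Z" for z
  proof -
    have "poly p z = (\<Sum>j<n. b j * (\<Prod>k\<in>{..<n} - {j}. z - x k))"
      by (simp add: p_def poly_sum poly_q)
    also have "\<dots> = (\<Sum>j<n. (\<Prod>k<n. z - x k) * (b j / (z - x j)))"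
    proof (intro sum.cong refl)
      fix i assume i: "i \<in> {..<n}"
      then have "(\<Prod>k<n. z - x k) = (z - x i) * (\<Prod>k\<in>{..<n} - {i}. z - x k)"
        by (simp add: prod.remove)
      then show "b i * (\<Prod>k\<in>{..<n} - {i}. z - x k) = (\<Prod>k<n. z - x k) * (b i / (z - x i))"
        using nodes[OF z] i by simp
    qed
    also have "\<dots> = 0" unfolding sum_distrib_left[symmetric] zero[OF z] by simp
    finally show ?thesis .
  qed
  have "p = 0"
  proof (rule ccontr)
    assume p: "p \<noteq> 0"
    have "card Z \<le> card {z. poly p z = 0}"
      using root poly_roots_finite[OF p] by (intro card_mono) auto
    also have "\<dots> \<le> degree p" using p by (rule card_poly_roots_bound)
    finally show False using deg Z by simp
  qed
  have "poly p (x j) = (\<Sum>i<n. if i = j then b j * poly (q j) (x j) else 0)"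
    unfolding p_def poly_sum
  proof (intro sum.cong refl)
    fix i assume i: "i \<in> {..<n}"
    show "poly (Polynomial.smult (b i) (q i)) (x j) = (if i = j then b j * poly (q j) (x j) else 0)"
      using i j by (auto simp: poly_q intro!: prod_zero)
  qed
  then have "b j * poly (q j) (x j) = 0" using \<open>p = 0\<close> j by simp
  moreover have "poly (q j) (x j) \<noteq> 0"
    using inj j by (auto simp: poly_q inj_on_def)
  ultimately show ?thesis by simp
qed

lemma singular_mat_kernel_vector:
  fixes A :: "'a::field mat"
  assumes A: "A \<in> carrier_mat n n" and sing: "\<not> invertible_mat A"
  obtains v where "\<exists>i<n. v i \<noteq> 0" "\<And>i. i < n \<Longrightarrow> (\<Sum>j<n. A $$ (i, j) * v j) = 0"
proof -
  have "Determinant.det A = 0"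
  proof (rule ccontr)
    assume "Determinant.det A \<noteq> 0"
    from det_non_zero_imp_unit[OF A this, of undefined]
    obtain B where "B \<in> carrier_mat n n" "B * A = 1\<^sub>m n" "A * B = 1\<^sub>m n"
      by (auto simp: Units_def ring_mat_def)
    then have "invertible_mat A"
      using A by (auto simp: invertible_mat_def inverts_mat_def square_mat.simps)
    with sing show False ..
  qed
  then obtain v where v: "v \<in> carrier_vec n" "v \<noteq> 0\<^sub>v n" "A *\<^sub>v v = 0\<^sub>v n"
    using det_0_iff_vec_prod_zero[OF A] by auto
  have "\<exists>i<n. vec_index v i \<noteq> 0"
    using v(1,2) by (metis eq_vecI carrier_vecD index_zero_vec)
  moreover have "(\<Sum>j<n. A $$ (i, j) * vec_index v j) = 0" if i: "i < n" for i
  proof -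
    have "vec_index (A *\<^sub>v v) i = (\<Sum>j<n. A $$ (i, j) * vec_index v j)"
      using A v(1) i by (auto simp: scalar_prod_def atLeast0LessThan intro!: sum.cong)
    then show ?thesis using v(3) i by simp
  qed
  ultimately show thesis by (rule that)
qed

section \<open>The Pick matrix and its kernel vectors\<close>

locale pick_data =
  fixes n l :: nat and x w \<gamma> \<xi> :: "nat \<Rightarrow> real"
  assumes data: "interpolation_data n l x \<xi>"
begin

lemma l_le_n: "l \<le> n" and x_inj: "inj_on x {..<n}"
  and \<xi>_nonzero: "l \<le> k \<Longrightarrow> k < n \<Longrightarrow> \<xi> k \<noteq> 0"
  using data by (auto simp: interpolation_data_def)

lemma x_eq_iff: "i < n \<Longrightarrow> j < n \<Longrightarrow> x i = x j \<longleftrightarrow> i = j"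
  using x_inj by (auto simp: inj_on_def)

definition nE :: "nat \<Rightarrow> real" where "nE i = (if i < l then 1 else 0)"
definition nC :: "nat \<Rightarrow> real" where "nC i = (if i < l then w i else \<xi> i)"
definition P :: "nat \<Rightarrow> nat \<Rightarrow> complex" where
  "P i j = complex_of_real (pick_mat n l x w \<gamma> \<xi> $$ (i, j))"

lemma nE_nC_nonzero: "i < n \<Longrightarrow> nE i \<noteq> 0 \<or> nC i \<noteq> 0"
  using \<xi>_nonzero[of i] by (auto simp: nE_def nC_def)

lemma P_offdiag:
  assumes "i < n" "j < n" "i \<noteq> j"
  shows "P i j = complex_of_real ((nE i * nC j - nC i * nE j) / (x j - x i))"
  using assms x_eq_iff[OF assms(1,2)]
  by (auto simp: P_def pick_mat_def nE_def nC_def divide_simps) (simp add: algebra_simps)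

lemma P_displacement:
  assumes "i < n" "j < n"
  shows "complex_of_real (x j - x i) * P i j = complex_of_real (nE i * nC j - nC i * nE j)"
proof (cases "i = j")
  case False
  then show ?thesis
    using x_eq_iff[OF assms] unfolding P_offdiag[OF assms False] of_real_mult[symmetric] by simp
qed simp

lemma P_diag: "i < n \<Longrightarrow> P i i = complex_of_real (if i < l then \<gamma> i else - \<xi> i)"
  by (auto simp: P_def pick_mat_def)

lemma P_real: "cnj (P i j) = P i j"
  by (simp add: P_def)

lemma P_sym:
  assumes "i < n" "j < n"
  shows "P j i = P i j"
proof (cases "i = j")
  case False
  then show ?thesis
    using x_eq_iff[OF assms] unfolding P_offdiag[OF assms False] P_offdiag[OF assms(2,1) False[symmetric]]
    by (intro arg_cong[of _ _ complex_of_real]) (simp add: divide_simps, simp add: algebra_simps)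
qed simp

lemma P_hermitian: "hermitian n P"
  unfolding hermitian_def using P_sym P_real by metis

lemma pick_index_eq: "pick_index n l x w \<gamma> \<xi> = sq_neg (fun_mat n P)"
proof -
  have "map_mat complex_of_real (pick_mat n l x w \<gamma> \<xi>) = fun_mat n P"
    by (rule eq_matI) (auto simp: P_def pick_mat_def)
  then show ?thesis by (simp add: pick_index_def)
qed

definition ker :: "(nat \<Rightarrow> complex) \<Rightarrow> bool" where
  "ker v \<longleftrightarrow> (\<forall>i<n. mvec n P v i = 0)"

text \<open>With the notation of the introduction, \<open>res v z\<close> is the resolvent vector
  \<open>(z - X)^-1 v\<close>, and \<open>den v z\<close> and \<open>num v z\<close> are its images
  under \<open>E\<close> and \<open>C\<close>.\<close>

definition den :: "(nat \<Rightarrow> complex) \<Rightarrow> complex \<Rightarrow> complex" where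
  "den v z = (\<Sum>j<n. complex_of_real (nE j) * v j / (z - complex_of_real (x j)))"

definition num :: "(nat \<Rightarrow> complex) \<Rightarrow> complex \<Rightarrow> complex" where
  "num v z = (\<Sum>j<n. complex_of_real (nC j) * v j / (z - complex_of_real (x j)))"

definition res :: "(nat \<Rightarrow> complex) \<Rightarrow> complex \<Rightarrow> nat \<Rightarrow> complex" where
  "res v z j = v j / (z - complex_of_real (x j))"

definition off_support :: "(nat \<Rightarrow> complex) \<Rightarrow> complex \<Rightarrow> bool" where
  "off_support v z \<longleftrightarrow> (\<forall>j<n. v j \<noteq> 0 \<longrightarrow> z \<noteq> complex_of_real (x j))"

lemma nonreal_off_support: "Im z \<noteq> 0 \<Longrightarrow> off_support v z"
  by (auto simp: off_support_def)

text \<open>Splitting z - x_k as (z - x_j) + (x_j - x_k) in each term, the first part cancels the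
  denominators and leaves row \<open>k\<close> of \<open>P v\<close>, which is 0; the displacement
  identity evaluates the second.\<close>

lemma mvec_res:
  assumes v: "ker v" and z: "off_support v z" and k: "k < n"
  shows "(z - complex_of_real (x k)) * mvec n P (res v z) k
    = complex_of_real (nE k) * num v z - complex_of_real (nC k) * den v z"
proof -
  have "(z - complex_of_real (x k)) * mvec n P (res v z) k
      = (\<Sum>j<n. P k j * v j
        + (complex_of_real (nE k * nC j - nC k * nE j)) * (v j / (z - complex_of_real (x j))))"
    unfolding mvec_def sum_distrib_left
  proof (intro sum.cong refl)
    fix j assume "j \<in> {..<n}"
    then have j: "j < n" by simp
    show "(z - complex_of_real (x k)) * (P k j * res v z j)
        = P k j * v j + (complex_of_real (nE k * nC j - nC k * nE j)) * (v j / (z - complex_of_real (x j)))"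
    proof (cases "v j = 0")
      case False
      then have "z \<noteq> complex_of_real (x j)" using z j by (auto simp: off_support_def)
      then show ?thesis unfolding P_displacement[OF k j, symmetric]
        by (simp add: res_def divide_simps) (simp add: algebra_simps)
    qed (simp add: res_def)
  qed
  also have "\<dots> = mvec n P v k + (complex_of_real (nE k) * num v z - complex_of_real (nC k) * den v z)"
    unfolding sum.distrib mvec_def num_def den_def sum_distrib_left sum_subtractf[symmetric]
    by (intro arg_cong2[of _ _ _ _ "(+)"] sum.cong refl) (simp add: algebra_simps)
  finally show ?thesis using v k by (simp add: ker_def)
qed

text \<open>The difference of the two sides is the bilinear pairing of \<open>u\<close> with
  \<open>P\<close> applied to \<open>res v z\<close>; by symmetry of the real matrix
  \<open>P\<close> it falls on \<open>P u = 0\<close>. So all kernel vectors define the same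
  quotient; the cross-multiplied form tolerates zero denominators.\<close>

lemma num_den_proportional:
  assumes u: "ker u" and v: "ker v" and z: "\<And>j. j < n \<Longrightarrow> z \<noteq> complex_of_real (x j)"
  shows "den u z * num v z = den v z * num u z"
proof -
  have off: "off_support v z" using z by (auto simp: off_support_def)
  have "den u z * num v z - num u z * den v z
      = (\<Sum>k<n. res u z k * ((z - complex_of_real (x k)) * mvec n P (res v z) k))"
    unfolding den_def[of u] num_def[of u] sum_distrib_right sum_subtractf[symmetric]
    by (intro sum.cong refl, simp only: mvec_res[OF v off] lessThan_iff)
      (simp add: res_def algebra_simps divide_inverse)
  also have "\<dots> = (\<Sum>k<n. u k * mvec n P (res v z) k)"
    using z by (intro sum.cong refl) (simp add: res_def)
  also have "\<dots> = herm_form n P (\<lambda>k. cnj (u k)) (res v z)"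
    by (simp add: herm_form_def)
  also have "\<dots> = (\<Sum>k<n. cnj (mvec n P (\<lambda>k. cnj (u k)) k) * res v z k)"
    by (rule herm_form_adjoint[OF P_hermitian, symmetric])
  also have "\<dots> = (\<Sum>k<n. mvec n P u k * res v z k)"
    by (simp add: mvec_def P_real)
  also have "\<dots> = 0" using u by (simp add: ker_def)
  finally show ?thesis by (simp add: mult.commute)
qed

text \<open>The kernel formula of the introduction before division by the denominators. The factor z
  - x_k is rewritten as (z - cnj \<zeta>) + (cnj \<zeta> - x_k); the second part cancels the
  conjugated resolvent and leaves a pairing with \<open>v\<close>, which vanishes.\<close>

lemma num_den_kernel:
  assumes v: "ker v" and z: "Im z \<noteq> 0" and \<zeta>: "Im \<zeta> \<noteq> 0"
  shows "cnj (den v \<zeta>) * num v z - cnj (num v \<zeta>) * den v z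
    = (z - cnj \<zeta>) * herm_form n P (res v \<zeta>) (res v z)"
proof -
  have nz: "z \<noteq> complex_of_real (x j)" "cnj \<zeta> \<noteq> complex_of_real (x j)" for j
    using z \<zeta> by (auto simp: complex_eq_iff)
  have "cnj (den v \<zeta>) * num v z - cnj (num v \<zeta>) * den v z
      = (\<Sum>k<n. cnj (res v \<zeta> k) * ((z - complex_of_real (x k)) * mvec n P (res v z) k))"
    unfolding den_def[of v \<zeta>] num_def[of v \<zeta>] cnj_sum sum_distrib_right sum_subtractf[symmetric]
    by (intro sum.cong refl, simp only: mvec_res[OF v nonreal_off_support[OF z]] lessThan_iff)
      (simp add: res_def algebra_simps divide_inverse)
  also have "\<dots> = (\<Sum>k<n. cnj (v k) * mvec n P (res v z) k
      + (z - cnj \<zeta>) * (cnj (res v \<zeta> k) * mvec n P (res v z) k))"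
  proof (intro sum.cong refl)
    fix k
    have "cnj (res v \<zeta> k) * (z - complex_of_real (x k))
        = cnj (v k) + (z - cnj \<zeta>) * cnj (res v \<zeta> k)"
      using nz(2)[of k] by (simp add: res_def field_simps)
    then show "cnj (res v \<zeta> k) * ((z - complex_of_real (x k)) * mvec n P (res v z) k)
        = cnj (v k) * mvec n P (res v z) k + (z - cnj \<zeta>) * (cnj (res v \<zeta> k) * mvec n P (res v z) k)"
      by (metis (no_types, lifting) distrib_right mult.assoc)
  qed
  also have "\<dots> = herm_form n P v (res v z) + (z - cnj \<zeta>) * herm_form n P (res v \<zeta>) (res v z)"
    unfolding herm_form_def sum.distrib sum_distrib_left ..
  also have "herm_form n P v (res v z) = 0"
    unfolding herm_form_adjoint[OF P_hermitian, symmetric] using v by (simp add: ker_def)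
  finally show ?thesis by simp
qed

text \<open>If \<open>den v\<close> vanished at \<open>n\<close> points, partial fractions would
  kill \<open>v\<close> at all regular nodes. On the singular nodes \<open>P\<close> is diagonal
  with entries -\<xi>, all nonzero, so \<open>P v = 0\<close> would kill the rest as well.\<close>

lemma ker_den_nonzero:
  assumes v: "ker v" and nz: "\<exists>i<n. v i \<noteq> 0" and Z: "finite Z" "card Z \<ge> n"
    and nodes: "\<And>z j. z \<in> Z \<Longrightarrow> j < n \<Longrightarrow> z \<noteq> complex_of_real (x j)"
  shows "\<exists>z\<in>Z. den v z \<noteq> 0"
proof (rule ccontr)
  assume 0: "\<not> ?thesis"
  have E0: "complex_of_real (nE j) * v j = 0" if "j < n" for j
  proof (rule partial_fractions_zero[OF _ Z])
    show "inj_on (\<lambda>j. complex_of_real (x j)) {..<n}" using x_inj by (auto simp: inj_on_def)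
  qed (use 0 nodes that in \<open>auto simp: den_def\<close>)
  then have vl: "v j = 0" if "j < l" for j using that l_le_n E0[of j] by (simp add: nE_def)
  have "v i = 0" if i: "i < n" "l \<le> i" for i
  proof -
    have "P i j * v j = (if j = i then P i i * v i else 0)" if "j < n" for j
      using P_offdiag[OF i(1) that] vl[of j] i by (auto simp: nE_def)
    then have "mvec n P v i = (\<Sum>j<n. if j = i then P i i * v i else 0)"
      unfolding mvec_def by (intro sum.cong) auto
    also have "\<dots> = P i i * v i" using i by simp
    finally show ?thesis using v i P_diag[of i] \<xi>_nonzero[of i] by (auto simp: ker_def)
  qed
  then show False using nz vl by (meson not_less)
qed

end

section \<open>The candidate solution\<close>

lemma herm_form_add_left:
  "herm_form n a (\<lambda>i. x i + y i) z = herm_form n a x z + herm_form n a y z"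
  by (simp add: herm_form_def algebra_simps sum.distrib)

lemma herm_form_add_right:
  "herm_form n a z (\<lambda>i. x i + y i) = herm_form n a z x + herm_form n a z y"
  unfolding herm_form_def mvec_add by (simp add: algebra_simps sum.distrib)

lemma herm_form_combination:
  "herm_form n a (\<lambda>i. \<Sum>r<m. X r i * q r) (\<lambda>i. \<Sum>r<m. X r i * q r)
    = herm_form m (\<lambda>r s. herm_form n a (X r) (X s)) q q"
proof -
  have "herm_form n a (\<lambda>i. \<Sum>r<m. X r i * q r) (\<lambda>i. \<Sum>r<m. X r i * q r)
      = (\<Sum>i<n. \<Sum>r<m. \<Sum>s<m. cnj (q r) * (cnj (X r i) * mvec n a (X s) i) * q s)"
    unfolding herm_form_def mvec_sum cnj_sum sum_product by (simp add: mult_ac)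
  also have "\<dots> = (\<Sum>r<m. \<Sum>i<n. \<Sum>s<m. cnj (q r) * (cnj (X r i) * mvec n a (X s) i) * q s)"
    by (rule sum.swap)
  also have "\<dots> = (\<Sum>r<m. \<Sum>s<m. \<Sum>i<n. cnj (q r) * (cnj (X r i) * mvec n a (X s) i) * q s)"
    by (intro sum.cong refl sum.swap)
  also have "\<dots> = herm_form m (\<lambda>r s. herm_form n a (X r) (X s)) q q"
    unfolding herm_form_def mvec_def[of m] sum_distrib_left sum_distrib_right
    by (intro sum.cong refl) (simp add: mult_ac)
  finally show ?thesis .
qed

lemma hermitian_nevanlinna_kernel: "hermitian m (\<lambda>i j. nevanlinna_kernel f (z j) (z i))"
proof -
  have "cnj (nevanlinna_kernel f u v) = nevanlinna_kernel f v u" for u v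
  proof -
    have "cnj (nevanlinna_kernel f u v) = (- (f v - cnj (f u))) / (- (v - cnj u))"
      by (simp add: nevanlinna_kernel_def)
    then show ?thesis unfolding minus_divide_divide nevanlinna_kernel_def .
  qed
  then show ?thesis unfolding hermitian_def by metis
qed

section \<open>Real kernel vectors of minimal support\<close>

context pick_data
begin

lemma ker_iff: "ker u \<longleftrightarrow> (\<forall>i<n. (\<Sum>j<n. P i j * u j) = 0)"
  by (simp add: ker_def mvec_def)

lemma ker_cnj: "ker u \<Longrightarrow> ker (\<lambda>i. cnj (u i))"
proof -
  assume u: "ker u"
  have "mvec n P (\<lambda>i. cnj (u i)) i = cnj (mvec n P u i)" for i
    by (simp add: mvec_def P_real)
  then show ?thesis using u by (simp add: ker_def)
qed

lemma minimal_kernel_vector: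
  assumes sing: "\<not> invertible_mat (pick_mat n l x w \<gamma> \<xi>)"
  obtains v where "ker v" "\<exists>i<n. v i \<noteq> 0" "\<And>i. i < n \<Longrightarrow> cnj (v i) = v i"
    and "\<And>u. ker u \<Longrightarrow> (\<And>i. i < n \<Longrightarrow> v i = 0 \<Longrightarrow> u i = 0) \<Longrightarrow> \<exists>t. \<forall>i<n. u i = t * v i"
proof -
  have "pick_mat n l x w \<gamma> \<xi> \<in> carrier_mat n n" by (simp add: pick_mat_def)
  from singular_mat_kernel_vector[OF this sing]
  obtain v0 :: "nat \<Rightarrow> real" where v0: "\<exists>i<n. v0 i \<noteq> 0"
    "\<And>i. i < n \<Longrightarrow> (\<Sum>j<n. pick_mat n l x w \<gamma> \<xi> $$ (i, j) * v0 j) = 0" by metis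
  let ?Q = "\<lambda>u. ker u \<and> (\<exists>i<n. u i \<noteq> 0)"
  have "?Q (\<lambda>i. complex_of_real (v0 i))"
    using v0 unfolding ker_iff P_def of_real_mult[symmetric] of_real_sum[symmetric] by auto
  from ex_has_least_nat[of ?Q, OF this, of "\<lambda>u. card {i. i < n \<and> u i \<noteq> 0}"]
  obtain v where v: "ker v" "\<exists>i<n. v i \<noteq> 0"
    and least: "\<And>u. ker u \<Longrightarrow> \<exists>i<n. u i \<noteq> 0 \<Longrightarrow>
      card {i. i < n \<and> v i \<noteq> 0} \<le> card {i. i < n \<and> u i \<noteq> 0}" by blast
  obtain i0 where i0: "i0 < n" "v i0 \<noteq> 0" using v(2) by blast
  have mult: "\<forall>i<n. u i = u i0 / v i0 * v i"
    if u: "ker u" and supp: "\<And>i. i < n \<Longrightarrow> v i = 0 \<Longrightarrow> u i = 0" for u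
  proof (rule ccontr)
    assume not: "\<not> ?thesis"
    \<comment> \<open>Subtracting this multiple of \<open>v\<close> cancels the entry at
      \<open>i0\<close>, so a nonzero remainder would be a kernel vector of smaller support.\<close>
    let ?u = "\<lambda>i. u i - u i0 / v i0 * v i"
    have "ker ?u" using u v(1) unfolding ker_def mvec_diff mvec_scale by simp
    moreover have "\<exists>i<n. ?u i \<noteq> 0" using not by auto
    ultimately have "card {i. i < n \<and> v i \<noteq> 0} \<le> card {i. i < n \<and> ?u i \<noteq> 0}" by (rule least)
    moreover have "{i. i < n \<and> ?u i \<noteq> 0} \<subseteq> {i. i < n \<and> v i \<noteq> 0} - {i0}"
      using supp i0 by auto
    then have "card {i. i < n \<and> ?u i \<noteq> 0} \<le> card ({i. i < n \<and> v i \<noteq> 0} - {i0})"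
      by (intro card_mono) auto
    moreover have "card ({i. i < n \<and> v i \<noteq> 0} - {i0}) < card {i. i < n \<and> v i \<noteq> 0}"
      using i0 by (intro card_Diff1_less) auto
    ultimately show False by linarith
  qed
  \<comment> \<open>Normalised to be 1 at \<open>i0\<close>. The conjugate is again a kernel vector
    with the same support and the same entry at \<open>i0\<close>, so proportionality makes the two
    equal.\<close>
  let ?v = "\<lambda>i. inverse (v i0) * v i"
  show thesis
  proof (rule that[of ?v])
    show kv: "ker ?v" using v(1) unfolding ker_def mvec_scale by simp
    show "\<exists>i<n. ?v i \<noteq> 0" using i0 by auto
    show "cnj (?v i) = ?v i" if "i < n" for i
    proof -
      have "\<forall>i<n. cnj (?v i) = cnj (?v i0) / v i0 * v i"
        by (rule mult[OF ker_cnj[OF kv]]) auto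
      then show ?thesis using that i0 by (simp add: divide_inverse)
    qed
    show "\<exists>t. \<forall>i<n. u i = t * ?v i"
      if "ker u" "\<And>i. i < n \<Longrightarrow> ?v i = 0 \<Longrightarrow> u i = 0" for u
    proof -
      have "\<forall>i<n. u i = u i0 / v i0 * v i" using that i0 by (intro mult) auto
      then have "\<forall>i<n. u i = u i0 * ?v i" by (simp add: divide_inverse mult.assoc)
      then show ?thesis by blast
    qed
  qed
qed

lemma den_analytic: "(\<And>j. j < n \<Longrightarrow> z \<noteq> complex_of_real (x j)) \<Longrightarrow> den v analytic_on {z}"
  unfolding den_def by (intro analytic_intros) auto

lemma num_analytic: "(\<And>j. j < n \<Longrightarrow> z \<noteq> complex_of_real (x j)) \<Longrightarrow> num v analytic_on {z}"
  unfolding num_def by (intro analytic_intros) auto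

lemma finite_den_zeros:
  assumes v: "ker v" and nz: "\<exists>i<n. v i \<noteq> 0"
  shows "finite {z. (\<forall>j<n. z \<noteq> complex_of_real (x j)) \<and> den v z = 0}" (is "finite ?A")
proof (rule ccontr)
  assume "infinite ?A"
  from infinite_arbitrarily_large[OF this, of n]
  obtain Z where Z: "finite Z" "card Z = n" "Z \<subseteq> ?A" by (elim exE conjE)
  have "\<exists>z\<in>Z. den v z \<noteq> 0"
    by (rule ker_den_nonzero[OF v nz Z(1)]) (use Z(2,3) in \<open>simp, blast\<close>)
  then show False using Z(3) by blast
qed

end

section \<open>The candidate function and its kernel\<close>

locale pick_minimal = pick_data +
  fixes v :: "nat \<Rightarrow> complex"
  assumes ker_v: "ker v" and v_nonzero: "\<exists>i<n. v i \<noteq> 0"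
    and v_real: "\<And>i. i < n \<Longrightarrow> cnj (v i) = v i"
    and v_minimal: "\<And>u. ker u \<Longrightarrow> (\<And>i. i < n \<Longrightarrow> v i = 0 \<Longrightarrow> u i = 0)
      \<Longrightarrow> \<exists>t. \<forall>i<n. u i = t * v i"
begin

text \<open>At a zero of the denominator the quotient is 0 by convention, which is exactly the value
  that the normal form prescribes at a pole.\<close>

definition sol :: "complex \<Rightarrow> complex" where "sol z = num v z / den v z"

definition rep :: "complex \<Rightarrow> nat \<Rightarrow> complex" where "rep z j = res v z j / den v z"

text \<open>If the resolvent vector lies in the kernel, minimality makes it proportional to \<open>v\<close>, which
  forces the support of \<open>v\<close> to be a single node.\<close>

lemma no_common_zero:
  assumes z: "off_support v z" and kr: "ker (res v z)"
  shows "den v z \<noteq> 0 \<or> num v z \<noteq> 0"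
proof -
  obtain t where t: "\<And>i. i < n \<Longrightarrow> res v z i = t * v i"
    using v_minimal[OF kr] by (auto simp: res_def)
  obtain i0 where i0: "i0 < n" "v i0 \<noteq> 0" using v_nonzero by blast
  have inv: "t * (z - complex_of_real (x j)) = 1" if "j < n" "v j \<noteq> 0" for j
  proof -
    have "v j / (z - complex_of_real (x j)) = t * v j" "z - complex_of_real (x j) \<noteq> 0"
      using t[OF that(1)] z that by (auto simp: res_def off_support_def)
    then have "v j * (t * (z - complex_of_real (x j))) = v j * 1"
      by (simp add: divide_eq_eq mult_ac)
    then show ?thesis using that(2) unfolding mult_cancel_left by simp
  qed
  have single: "v j = 0" if j: "j < n" "j \<noteq> i0" for j
  proof (rule ccontr)
    assume "v j \<noteq> 0"
    then have "t * (z - complex_of_real (x j)) = t * (z - complex_of_real (x i0))"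
      using inv[OF j(1)] inv[OF i0] by simp
    moreover have "t \<noteq> 0" using inv[OF i0] by auto
    ultimately show False using x_eq_iff[OF j(1) i0(1)] j by simp
  qed
  have "den v z = (\<Sum>j<n. if j = i0 then complex_of_real (nE i0) * v i0 / (z - complex_of_real (x i0)) else 0)"
    unfolding den_def using single by (intro sum.cong) auto
  then have d: "den v z = complex_of_real (nE i0) * v i0 / (z - complex_of_real (x i0))"
    using i0 by simp
  have "num v z = (\<Sum>j<n. if j = i0 then complex_of_real (nC i0) * v i0 / (z - complex_of_real (x i0)) else 0)"
    unfolding num_def using single by (intro sum.cong) auto
  then have "num v z = complex_of_real (nC i0) * v i0 / (z - complex_of_real (x i0))"
    using i0 by simp
  with d show ?thesis using nE_nC_nonzero[OF i0(1)] i0 inv[OF i0] by auto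
qed

text \<open>A common zero would make every row of \<open>P\<close> annihilate the resolvent vector,
  the situation excluded by \<open>no_common_zero\<close>. Consequently each zero of
  \<open>den v\<close> in the upper half plane is a pole of \<open>sol\<close>.\<close>

lemma nonreal_no_common_zero:
  assumes z: "Im z \<noteq> 0"
  shows "den v z \<noteq> 0 \<or> num v z \<noteq> 0"
proof (rule ccontr)
  assume 0: "\<not> ?thesis"
  have "mvec n P (res v z) k = 0" if k: "k < n" for k
  proof -
    have "z \<noteq> complex_of_real (x k)" using z by auto
    then show ?thesis using mvec_res[OF ker_v nonreal_off_support[OF z] k] 0 by simp
  qed
  then have "ker (res v z)" by (simp add: ker_def)
  then show False using no_common_zero[OF nonreal_off_support[OF z]] 0 by simp
qed

lemma eventually_den_nonzero: "eventually (\<lambda>z. den v z \<noteq> 0) (at z0)"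
proof -
  let ?Z = "{z. (\<forall>j<n. z \<noteq> complex_of_real (x j)) \<and> den v z = 0} \<union> (\<lambda>j. complex_of_real (x j)) ` {..<n}"
  have "finite ?Z" using finite_den_zeros[OF ker_v v_nonzero] by simp
  then have "eventually (\<lambda>z. z \<notin> ?Z) (at z0)"
    using islimpt_finite[of ?Z z0] by (auto simp: islimpt_iff_eventually)
  then show ?thesis by eventually_elim auto
qed

lemma sol_pole:
  assumes z: "Im z \<noteq> 0" and "den v z = 0"
  shows "is_pole sol z"
proof -
  have nodes: "z \<noteq> complex_of_real (x j)" for j using z by auto
  have "isCont (num v) z" "isCont (den v) z"
    using num_analytic den_analytic nodes analytic_at_imp_isCont by blast+
  moreover from this(2) have "filterlim (den v) (at 0) (at z)"
    unfolding filterlim_at using assms(2) eventually_den_nonzero[of z] by (auto simp: isCont_def)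
  ultimately show ?thesis
    unfolding sol_def using nonreal_no_common_zero[OF z] assms(2) by (intro is_pole_divide) auto
qed

lemma sol_analytic:
  assumes z: "Im z \<noteq> 0" and "den v z \<noteq> 0"
  shows "sol analytic_on {z}"
proof -
  have "z \<noteq> complex_of_real (x j)" for j using z by auto
  then show ?thesis unfolding sol_def using assms(2)
    by (intro analytic_on_divide num_analytic den_analytic) auto
qed

lemma sol_nicely_meromorphic: "sol nicely_meromorphic_on {z. Im z > 0}"
proof -
  have mero: "sol meromorphic_on {z. Im z > 0}"
  proof -
    have "num v analytic_on {z. Im z > 0}" "den v analytic_on {z. Im z > 0}"
      by (subst analytic_on_analytic_at; force intro: num_analytic den_analytic)+
    then show ?thesis unfolding sol_def
      by (intro meromorphic_on_divide analytic_on_imp_meromorphic_on)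
  qed
  moreover have "(is_pole sol z \<and> sol z = 0) \<or> sol \<midarrow>z\<rightarrow> sol z" if "Im z > 0" for z
  proof (cases "den v z = 0")
    case True
    then show ?thesis using sol_pole[of z] that by (simp add: sol_def)
  next
    case False
    then show ?thesis
      using sol_analytic[of z] that analytic_at_imp_isCont[of sol z] by (simp add: isCont_def)
  qed
  ultimately show ?thesis by (auto simp: nicely_meromorphic_on_def)
qed

lemma sol_domain: "analyticity_domain sol = {z. Im z > 0 \<and> den v z \<noteq> 0}"
proof -
  have "\<not> sol analytic_on {z}" if "Im z > 0" "den v z = 0" for z
    using sol_pole[of z] that analytic_at_imp_isCont[of sol z]
      not_tendsto_and_filterlim_at_infinity[of "at z" sol "sol z"]
    by (auto simp: is_pole_def isCont_def)
  then show ?thesis using sol_analytic by (force simp: analyticity_domain_def)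
qed

lemma sol_kernel:
  assumes "z \<in> analyticity_domain sol" "\<zeta> \<in> analyticity_domain sol"
  shows "nevanlinna_kernel sol z \<zeta> = herm_form n P (rep \<zeta>) (rep z)"
proof -
  have z: "Im z > 0" "den v z \<noteq> 0" and \<zeta>: "Im \<zeta> > 0" "den v \<zeta> \<noteq> 0"
    using assms by (auto simp: sol_domain)
  have nz: "z - cnj \<zeta> \<noteq> 0" using z \<zeta> by (auto simp: complex_eq_iff)
  have "herm_form n P (rep \<zeta>) (rep z) = herm_form n P (res v \<zeta>) (res v z) / (cnj (den v \<zeta>) * den v z)"
  proof -
    have eq: "rep z = (\<lambda>j. inverse (den v z) * res v z j)"
      by (rule ext) (simp add: rep_def divide_inverse)
    have "mvec n P (rep z) k = inverse (den v z) * mvec n P (res v z) k" for k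
      unfolding eq by (rule mvec_scale)
    then show ?thesis unfolding herm_form_def sum_divide_distrib
      by (intro sum.cong refl) (simp add: rep_def divide_inverse)
  qed
  also have "\<dots> = (cnj (den v \<zeta>) * num v z - cnj (num v \<zeta>) * den v z)
      / (z - cnj \<zeta>) / (cnj (den v \<zeta>) * den v z)"
    using num_den_kernel[OF ker_v, of z \<zeta>] z \<zeta> nz by simp
  also have "\<dots> = nevanlinna_kernel sol z \<zeta>"
    unfolding nevanlinna_kernel_def sol_def using z(2) \<zeta>(2) nz by (simp add: field_simps)
  finally show ?thesis ..
qed

text \<open>The vector \<open>g\<close> is supported on the support of \<open>v\<close> together
  with \<open>i\<close>, and \<open>P g\<close> is \<beta> times the unit vector at
  \<open>i\<close>, so the last conjunct says that the form of \<open>g\<close> is nonpositive. The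
  support condition makes witnesses of different nodes orthogonal for the form.\<close>

definition failure_witness :: "nat \<Rightarrow> (nat \<Rightarrow> complex) \<Rightarrow> complex \<Rightarrow> bool" where
  "failure_witness i g \<beta> \<longleftrightarrow>
     v i = 0 \<and> (\<forall>j<n. j \<noteq> i \<longrightarrow> v j = 0 \<longrightarrow> g j = 0) \<and> \<beta> \<noteq> 0 \<and>
     (\<forall>k<n. mvec n P g k = (if k = i then \<beta> else 0)) \<and> Re (cnj (g i) * \<beta>) \<le> 0"

text \<open>Negative vectors of the kernel matrix are lifted to combinations of
  \<open>rep (z r)\<close>, whose Gram matrix for \<open>P\<close> is that kernel matrix. They
  vanish on \<open>F\<close>, while \<open>P\<close> maps the witnesses into vectors supported on
  \<open>F\<close>; so the two families are orthogonal for the form and their sizes add up.\<close>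

lemma sol_index_bound:
  assumes z: "\<And>i. i < m \<Longrightarrow> z i \<in> analyticity_domain sol"
    and F: "F \<subseteq> {..<n}" "\<And>i. i \<in> F \<Longrightarrow> failure_witness i (g i) (\<beta> i)"
  shows "sq_neg (kernel_mat sol m z) + card F \<le> pick_index n l x w \<gamma> \<xi>"
proof -
  let ?K = "\<lambda>i j. nevanlinna_kernel sol (z j) (z i)"
  have finF: "finite F" using F(1) finite_subset by auto
  show ?thesis
  proof (rule sq_neg_negative_family[OF hermitian_nevanlinna_kernel, of m sol z])
    fix I :: "nat set" and p :: "nat \<Rightarrow> nat \<Rightarrow> complex" and \<delta> :: real
    assume I: "finite I" "card I = sq_neg (fun_mat m ?K)" and \<delta>: "\<delta> > 0"
      and neg: "\<And>c y. (\<And>i. i < m \<Longrightarrow> y i = (\<Sum>k\<in>I. p k i * c k)) \<Longrightarrow>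
        Re (herm_form m ?K y y) \<le> - \<delta> * (\<Sum>k\<in>I. (cmod (c k))\<^sup>2)"
    define Y where "Y = (\<lambda>k i. case k of Inl k \<Rightarrow> (\<Sum>r<m. rep (z r) i * p k r) | Inr k \<Rightarrow> g k i)"
    have "card (I <+> F) \<le> card ({} :: nat set) + sq_neg (fun_mat n P)"
    proof (rule card_le_sq_neg[OF P_hermitian, where Y = Y])
      fix c y
      assume c: "\<exists>k\<in>I <+> F. c k \<noteq> 0" and y: "\<And>i. y i = (\<Sum>k\<in>I <+> F. Y k i * c k)"
      define q where "q = (\<lambda>r. \<Sum>k\<in>I. p k r * c (Inl k))"
      define y1 where "y1 = (\<lambda>i. \<Sum>r<m. rep (z r) i * q r)"
      define y2 where "y2 = (\<lambda>i. \<Sum>k\<in>F. g k i * c (Inr k))"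
      have yy: "y = (\<lambda>i. y1 i + y2 i)"
      proof
        fix i
        have "(\<Sum>k\<in>I. Y (Inl k) i * c (Inl k)) = (\<Sum>k\<in>I. \<Sum>r<m. rep (z r) i * (p k r * c (Inl k)))"
          by (simp add: Y_def sum_distrib_right mult.assoc)
        also have "\<dots> = y1 i"
          by (subst sum.swap) (simp add: y1_def q_def sum_distrib_left)
        finally show "y i = y1 i + y2 i"
          unfolding y by (simp add: sum.Plus I finF Y_def y2_def)
      qed
      have y1_supp: "y1 i = 0" if "v i = 0" for i
        using that by (simp add: y1_def rep_def res_def)
      have Py2: "mvec n P y2 k = (if k \<in> F then \<beta> k * c (Inr k) else 0)" if k: "k < n" for k
      proof -
        have "mvec n P y2 k = (\<Sum>i\<in>F. if k = i then \<beta> k * c (Inr k) else 0)"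
          unfolding y2_def mvec_sum using F(2) k
          by (intro sum.cong) (auto simp: failure_witness_def)
        then show ?thesis using finF by simp
      qed
      have f12: "herm_form n P y1 y2 = 0"
        unfolding herm_form_def using y1_supp F(2)
        by (intro sum.neutral) (auto simp: Py2 failure_witness_def)
      have f21: "herm_form n P y2 y1 = 0"
        unfolding herm_form_adjoint[OF P_hermitian, symmetric] using y1_supp F(2)
        by (intro sum.neutral) (auto simp: Py2 failure_witness_def)
      have y2F: "y2 i = g i i * c (Inr i)" if i: "i \<in> F" for i
      proof -
        have "y2 i = (\<Sum>k\<in>F. if k = i then g i i * c (Inr i) else 0)"
          unfolding y2_def using F i
          by (intro sum.cong) (auto simp: failure_witness_def)
        then show ?thesis using finF i by simp
      qed
      have "herm_form n P y2 y2 = (\<Sum>i\<in>F. cnj (y2 i) * (\<beta> i * c (Inr i)))"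
        unfolding herm_form_def using F(1)
        by (intro sum.mono_neutral_cong_right) (auto simp: Py2)
      also have "\<dots> = (\<Sum>i\<in>F. complex_of_real ((cmod (c (Inr i)))\<^sup>2) * (cnj (g i i) * \<beta> i))"
        unfolding complex_norm_square by (intro sum.cong refl) (simp add: y2F mult_ac)
      finally have f22: "Re (herm_form n P y2 y2) \<le> 0"
        using F(2) by (auto simp: failure_witness_def intro!: sum_nonpos mult_nonneg_nonpos simp del: of_real_power)
      have "herm_form n P y1 y1 = herm_form m (\<lambda>r s. herm_form n P (rep (z r)) (rep (z s))) q q"
        unfolding y1_def by (rule herm_form_combination)
      also have "\<dots> = herm_form m ?K q q"
        unfolding herm_form_def[of m] mvec_def[of m] using sol_kernel z by (intro sum.cong refl) auto
      finally have f11: "Re (herm_form n P y1 y1) \<le> - \<delta> * (\<Sum>k\<in>I. (cmod (c (Inl k)))\<^sup>2)"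
        using neg[of q "\<lambda>k. c (Inl k)"] by (simp add: q_def)
      have nonneg: "\<delta> * (\<Sum>k\<in>I. (cmod (c (Inl k)))\<^sup>2) \<ge> 0"
        using \<delta> by (simp add: sum_nonneg)
      have "Re (herm_form n P y y) \<le> 0"
        unfolding yy herm_form_add_left herm_form_add_right f12 f21 using f11 f22 nonneg by simp
      \<comment> \<open>If \<open>P y = 0\<close>, pairing with \<open>y1\<close> makes the form of
        \<open>y1\<close> vanish, and the margin \<delta> kills the lifted coefficients. Then
        \<open>P y2 = 0\<close>, whose entries on \<open>F\<close> are \<beta> times the remaining
        coefficients.\<close>
      moreover have "\<exists>i<n. mvec n P y i \<noteq> 0"
      proof (rule ccontr)
        assume "\<not> ?thesis"
        then have My: "\<And>i. i < n \<Longrightarrow> mvec n P y i = 0" by auto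
        then have "herm_form n P y1 y = 0" by (simp add: herm_form_def)
        then have "herm_form n P y1 y1 = 0" unfolding yy herm_form_add_right f12 by simp
        then have "\<delta> * (\<Sum>k\<in>I. (cmod (c (Inl k)))\<^sup>2) = 0" using f11 nonneg by simp
        then have cI: "c (Inl k) = 0" if "k \<in> I" for k
          using \<delta> that I(1) by (simp add: sum_nonneg_eq_0_iff)
        then have "y1 = (\<lambda>i. 0)" by (simp add: y1_def q_def)
        then have "\<And>i. i < n \<Longrightarrow> mvec n P y2 i = 0" using My yy by simp
        then have "\<beta> i * c (Inr i) = 0" if "i \<in> F" for i
          using that F(1) Py2[of i] by (metis lessThan_iff subsetD)
        then have "c (Inr i) = 0" if "i \<in> F" for i
          using that F(2) by (auto simp: failure_witness_def)
        then show False using c cI by auto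
      qed
      ultimately show "Re (herm_form n P y y) \<le> 0 \<and> (\<exists>i<n. mvec n P y i \<noteq> 0)" ..
    qed (use I finF in auto)
    then show ?thesis
      using I finF by (simp add: card_Plus pick_index_eq kernel_mat_def)
  qed
qed

end

section \<open>Limits of functions and partial fractions at a node\<close>

lemma punctured_slope_limit:
  fixes f :: "complex \<Rightarrow> complex"
  assumes ana: "eventually (\<lambda>z. f analytic_on {z}) (at z0)"
    and slope: "((\<lambda>z. (f z - c) / (z - z0)) \<longlongrightarrow> d) (at z0)"
  shows "(f \<longlongrightarrow> c) (at z0)" and "(deriv f \<longlongrightarrow> d) (at z0)"
proof -
  \<comment> \<open>The value of \<open>f\<close> at \<open>z0\<close> itself may be arbitrary.
    After replacing it by \<open>c\<close>, the slope limit gives differentiability at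
    \<open>z0\<close>, hence holomorphy on a ball and continuity of the derivative there.\<close>
  define F where "F = (\<lambda>z. if z = z0 then c else f z)"
  obtain e where e: "e > 0" "\<And>z. z \<in> ball z0 e \<Longrightarrow> z \<noteq> z0 \<Longrightarrow> f analytic_on {z}"
    using ana unfolding eventually_at by (auto simp: dist_commute)
  have eqF: "eventually (\<lambda>u. F u = f u) (nhds z)" if "z \<noteq> z0" for z
  proof -
    have "eventually (\<lambda>u. u \<noteq> z0) (nhds z)" using that by (rule t1_space_nhds)
    then show ?thesis by eventually_elim (simp add: F_def)
  qed
  have "((\<lambda>z. (F z - F z0) / (z - z0)) \<longlongrightarrow> d) (at z0)"
    using slope by (rule Lim_transform_eventually) (simp add: F_def eventually_at_filter)
  then have F0: "(F has_field_derivative d) (at z0)"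
    by (simp add: has_field_derivative_iff)
  have "F field_differentiable (at z)" if "z \<in> ball z0 e" for z
  proof (cases "z = z0")
    case True
    then show ?thesis using F0 by (auto simp: field_differentiable_def)
  next
    case False
    then have "f field_differentiable (at z)"
      using e(2)[OF that] analytic_on_imp_differentiable_at by blast
    then obtain D where "(f has_field_derivative D) (at z)" by (auto simp: field_differentiable_def)
    then have "(F has_field_derivative D) (at z)"
      using DERIV_cong_ev[OF refl eqF[OF False] refl] by simp
    then show ?thesis by (auto simp: field_differentiable_def)
  qed
  then have hol: "F holomorphic_on ball z0 e"
    by (auto simp: holomorphic_on_def intro: field_differentiable_at_within)
  have "isCont F z0" using F0 by (rule DERIV_isCont)
  then have "(F \<longlongrightarrow> c) (at z0)" by (simp add: isCont_def F_def)
  then show "(f \<longlongrightarrow> c) (at z0)"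
    by (rule Lim_transform_eventually) (simp add: F_def eventually_at_filter)
  have "isCont (deriv F) z0"
    using holomorphic_on_imp_continuous_on[OF holomorphic_deriv[OF hol open_ball]] e(1)
    by (simp add: continuous_on_eq_continuous_at)
  then have "(deriv F \<longlongrightarrow> d) (at z0)"
    using DERIV_imp_deriv[OF F0] by (simp add: isCont_def)
  moreover have "deriv F z = deriv f z" if "z \<noteq> z0" for z
    by (rule deriv_cong_ev[OF eqF[OF that] refl])
  then have "eventually (\<lambda>z. deriv F z = deriv f z) (at z0)"
    by (simp add: eventually_at_filter)
  ultimately show "(deriv f \<longlongrightarrow> d) (at z0)" by (rule Lim_transform_eventually)
qed

lemma nontangential_limit_at:
  "filterlim f F (at (complex_of_real x)) \<Longrightarrow> nontangential_limit f F x"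
  unfolding nontangential_limit_def using filterlim_mono[OF _ order_refl at_le[OF subset_UNIV]] by blast

lemma partial_fractions_residue_limit:
  fixes b x :: "nat \<Rightarrow> complex"
  assumes inj: "inj_on x {..<n}" and i: "i < n"
  shows "((\<lambda>z. (z - x i) * (\<Sum>j<n. b j / (z - x j))) \<longlongrightarrow> b i) (at (x i))"
proof -
  have "((\<lambda>z. \<Sum>j<n. (z - x i) * (b j / (z - x j))) \<longlongrightarrow> (\<Sum>j<n. if j = i then b i else 0)) (at (x i))"
  proof (rule tendsto_sum)
    fix j assume j: "j \<in> {..<n}"
    show "((\<lambda>z. (z - x i) * (b j / (z - x j))) \<longlongrightarrow> (if j = i then b i else 0)) (at (x i))"
    proof (cases "j = i")
      case True
      have "((\<lambda>z. b i) \<longlongrightarrow> b i) (at (x i))" by simp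
      then have "((\<lambda>z. (z - x i) * (b i / (z - x i))) \<longlongrightarrow> b i) (at (x i))"
        by (rule Lim_transform_eventually) (simp add: eventually_at_filter)
      then show ?thesis using True by simp
    next
      case False
      then have "x i \<noteq> x j" using inj i j by (auto simp: inj_on_def)
      then have "((\<lambda>z. (z - x i) * (b j / (z - x j))) \<longlongrightarrow> (x i - x i) * (b j / (x i - x j))) (at (x i))"
        by (intro tendsto_intros) auto
      then show ?thesis using False by simp
    qed
  qed
  then show ?thesis using i by (simp add: sum_distrib_left)
qed

text \<open>As \<open>b i = 0\<close>, the \<open>i\<close>-th term is identically 0, even at the
  node by the convention for division by 0. The limit can therefore be written as the plain value of
  the sum.\<close>

lemma partial_fractions_regular_limit:
  fixes b x :: "nat \<Rightarrow> complex"
  assumes inj: "inj_on x {..<n}" and i: "i < n" and b: "b i = 0"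
  shows "((\<lambda>z. \<Sum>j<n. b j / (z - x j)) \<longlongrightarrow> (\<Sum>j<n. b j / (x i - x j))) (at (x i))"
proof (rule tendsto_sum)
  fix j assume j: "j \<in> {..<n}"
  show "((\<lambda>z. b j / (z - x j)) \<longlongrightarrow> b j / (x i - x j)) (at (x i))"
  proof (cases "j = i")
    case False
    then have "x i \<noteq> x j" using inj i j by (auto simp: inj_on_def)
    then show ?thesis by (intro tendsto_intros) auto
  qed (simp add: b)
qed

section \<open>Which nodes the candidate interpolates\<close>

context pick_minimal
begin

abbreviation X :: "nat \<Rightarrow> complex" where "X i \<equiv> complex_of_real (x i)"

definition row :: "nat \<Rightarrow> complex \<Rightarrow> complex" where "row k z = mvec n P (res v z) k"

lemma X_inj: "inj_on X {..<n}"
  using x_inj by (auto simp: inj_on_def)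

lemma row_eq: "row k z = (\<Sum>j<n. P k j * v j / (z - X j))"
  by (simp add: row_def mvec_def res_def)

lemma eventually_off_nodes: "eventually (\<lambda>z. \<forall>j<n. z \<noteq> X j) (at z0)"
proof -
  have "eventually (\<lambda>z. z \<notin> X ` {..<n}) (at z0)"
    using islimpt_finite[of "X ` {..<n}" z0] by (auto simp: islimpt_iff_eventually)
  then show ?thesis by eventually_elim auto
qed

lemma eventually_sol_analytic: "eventually (\<lambda>z. sol analytic_on {z}) (at z0)"
  using eventually_off_nodes[of z0] eventually_den_nonzero[of z0]
proof eventually_elim
  case (elim z)
  then show ?case unfolding sol_def
    by (intro analytic_on_divide num_analytic den_analytic) auto
qed

lemma row_identity:
  assumes "\<forall>j<n. z \<noteq> X j" "k < n"
  shows "(z - X k) * row k z = complex_of_real (nE k) * num v z - complex_of_real (nC k) * den v z"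
  unfolding row_def using assms by (intro mvec_res ker_v) (auto simp: off_support_def)

text \<open>At a regular node the resolvent identity says that \<open>row i z / den v z\<close> is
  the difference quotient of \<open>sol\<close> with prescribed value \<open>w i\<close>, so one
  limit controls both the value and the derivative.\<close>

lemma regular_node_slope:
  assumes i: "i < l" and lim: "((\<lambda>z. row i z / den v z) \<longlongrightarrow> complex_of_real d) (at (X i))"
    and d: "d \<le> \<gamma> i"
  shows "interpolates_at l x w \<gamma> \<xi> sol i"
proof -
  have "i < n" using i l_le_n by simp
  have ev: "eventually (\<lambda>z. row i z / den v z = (sol z - complex_of_real (w i)) / (z - X i)) (at (X i))"
    using eventually_off_nodes[of "X i"] eventually_den_nonzero[of "X i"]
  proof eventually_elim
    case (elim z)
    have "(z - X i) * row i z = num v z - complex_of_real (w i) * den v z"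
      using row_identity[OF elim(1) \<open>i < n\<close>] i by (simp add: nE_def nC_def)
    moreover have "z - X i \<noteq> 0" using elim(1) \<open>i < n\<close> by simp
    ultimately have "row i z = (num v z - complex_of_real (w i) * den v z) / (z - X i)"
      by (simp add: eq_divide_eq mult.commute)
    then show ?case using elim(2) by (simp add: sol_def diff_divide_distrib)
  qed
  have "((\<lambda>z. (sol z - complex_of_real (w i)) / (z - X i)) \<longlongrightarrow> complex_of_real d) (at (X i))"
    using lim ev by (rule Lim_transform_eventually)
  note lims = punctured_slope_limit[OF eventually_sol_analytic this]
  show ?thesis
    using nontangential_limit_at[OF lims(1)] nontangential_limit_at[OF lims(2)] i d
    by (auto simp: interpolates_at_def)
qed

text \<open>Row \<open>i\<close> has only regular columns and the diagonal, and \<xi> factors out.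
  The term \<open>j = i\<close> of the sum is 0 because \<open>nE i = 0\<close>. For
  \<open>u\<close> in the kernel this equates the value of \<open>den\<close> at the node with
  \<open>u i\<close>.\<close>

lemma singular_row:
  assumes i: "i < n" "l \<le> i"
  shows "mvec n P u i = complex_of_real (\<xi> i) * ((\<Sum>j<n. complex_of_real (nE j) * u j / (X i - X j)) - u i)"
proof -
  have "mvec n P u i = (\<Sum>j<n. complex_of_real (\<xi> i) * (complex_of_real (nE j) * u j / (X i - X j))
      - (if j = i then complex_of_real (\<xi> i) * u i else 0))"
    unfolding mvec_def
  proof (intro sum.cong refl)
    fix j assume "j \<in> {..<n}"
    then have j: "j < n" by simp
    show "P i j * u j = complex_of_real (\<xi> i) * (complex_of_real (nE j) * u j / (X i - X j))
      - (if j = i then complex_of_real (\<xi> i) * u i else 0)"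
    proof (cases "j = i")
      case False
      have "P i j = complex_of_real (\<xi> i) * (complex_of_real (nE j) / (X i - X j))"
        using P_offdiag[OF i(1) j False[symmetric]] x_eq_iff[OF i(1) j] False i(2)
        by (auto simp: nE_def nC_def divide_simps) (simp add: algebra_simps)
      then show ?thesis using False by simp
    qed (use P_diag[OF i(1)] i in simp)
  qed
  also have "\<dots> = complex_of_real (\<xi> i) * ((\<Sum>j<n. complex_of_real (nE j) * u j / (X i - X j)) - u i)"
    using i by (simp add: sum_subtractf right_diff_distrib sum_distrib_left)
  finally show ?thesis .
qed

text \<open>On the support the conditions hold with equality. At a regular node \<open>row i\<close>
  and \<open>den v\<close> have simple poles whose residues have quotient \<gamma>; at a singular
  node \<open>den v\<close> tends to \<open>v i\<close> and the residue of \<open>num v\<close> is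
  \<xi> times \<open>v i\<close>.\<close>

lemma interpolates_on_support:
  assumes i: "i < n" and vi: "v i \<noteq> 0"
  shows "interpolates_at l x w \<gamma> \<xi> sol i"
proof (cases "i < l")
  case True
  have "((\<lambda>z. ((z - X i) * row i z) / ((z - X i) * den v z)) \<longlongrightarrow>
      (P i i * v i) / (complex_of_real (nE i) * v i)) (at (X i))"
    unfolding row_eq den_def using True vi
    by (intro tendsto_divide partial_fractions_residue_limit[OF X_inj i]) (simp add: nE_def)
  moreover have "(P i i * v i) / (complex_of_real (nE i) * v i) = complex_of_real (\<gamma> i)"
    using True vi P_diag[OF i] by (simp add: nE_def)
  ultimately have "((\<lambda>z. ((z - X i) * row i z) / ((z - X i) * den v z)) \<longlongrightarrow>
      complex_of_real (\<gamma> i)) (at (X i))" by simp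
  then have "((\<lambda>z. row i z / den v z) \<longlongrightarrow> complex_of_real (\<gamma> i)) (at (X i))"
    by (rule Lim_transform_eventually) (simp add: eventually_at_filter)
  then show ?thesis by (rule regular_node_slope[OF True]) simp
next
  case False
  have den: "den v (X i) = v i"
    using singular_row[OF i, of v] ker_v i False \<xi>_nonzero[of i] by (simp add: ker_def den_def)
  have "(den v \<longlongrightarrow> den v (X i)) (at (X i))"
    unfolding den_def using False by (intro partial_fractions_regular_limit[OF X_inj i]) (simp add: nE_def)
  moreover have "((\<lambda>z. (z - X i) * num v z) \<longlongrightarrow> complex_of_real (nC i) * v i) (at (X i))"
    unfolding num_def by (rule partial_fractions_residue_limit[OF X_inj i])
  ultimately have "((\<lambda>z. ((z - X i) * num v z) / den v z) \<longlongrightarrow> complex_of_real (nC i) * v i / den v (X i)) (at (X i))"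
    using den vi by (intro tendsto_divide) auto
  then have "((\<lambda>z. (z - X i) * sol z) \<longlongrightarrow> complex_of_real (\<xi> i)) (at (X i))"
    using den vi False by (simp add: nC_def sol_def)
  from nontangential_limit_at[OF this] show ?thesis
    using False \<xi>_nonzero[of i] i by (auto simp: interpolates_at_def intro!: exI[of _ "\<xi> i"])
qed

definition unit :: "nat \<Rightarrow> nat \<Rightarrow> complex" where "unit i j = (if j = i then 1 else 0)"

lemma mvec_unit: "i < n \<Longrightarrow> mvec n P (unit i) k = P k i"
proof -
  assume i: "i < n"
  have "mvec n P (unit i) k = (\<Sum>j<n. if j = i then P k i else 0)"
    unfolding mvec_def unit_def by (intro sum.cong) auto
  then show ?thesis using i by simp
qed

text \<open>The witness is the resolvent vector at the node, corrected by the unit vector at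
  \<open>i\<close> unless \<open>D\<close> and \<open>N\<close> both vanish. The displacement
  identity cancels all rows other than \<open>i\<close>, and row \<open>i\<close> measures by how
  much the inequality fails.\<close>

lemma failure_at:
  assumes i: "i < n" and vi: "v i = 0" and fail: "\<not> interpolates_at l x w \<gamma> \<xi> sol i"
  shows "\<exists>g \<beta>. failure_witness i g \<beta>"
proof -
  define D where "D = den v (X i)"
  define N where "N = num v (X i)"
  define M where "M = row i (X i)"
  have off: "off_support v (X i)"
    using vi x_eq_iff[OF i] by (auto simp: off_support_def)
  have rowk: "(X i - X k) * mvec n P (res v (X i)) k = complex_of_real (nE k) * N - complex_of_real (nC k) * D"
    if "k < n" for k
    using mvec_res[OF ker_v off that] by (simp add: N_def D_def)
  have Pki: "(X i - X k) * P k i = complex_of_real (nE k * nC i - nC k * nE i)" if "k < n" for k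
    using P_displacement[OF that i] by simp
  have cancel: "a = b" if "(X i - X k) * a = (X i - X k) * b" "k < n" "k \<noteq> i" for a b k
    using that x_eq_iff[OF i that(2)] by simp
  have limD: "(den v \<longlongrightarrow> D) (at (X i))"
    unfolding den_def D_def using vi by (intro partial_fractions_regular_limit[OF X_inj i]) simp
  have limN: "(num v \<longlongrightarrow> N) (at (X i))"
    unfolding num_def N_def using vi by (intro partial_fractions_regular_limit[OF X_inj i]) simp
  have limM: "(row i \<longlongrightarrow> M) (at (X i))"
    unfolding row_eq M_def using vi by (intro partial_fractions_regular_limit[OF X_inj i]) simp
  have reals: "cnj D = D" "cnj N = N" "cnj M = M"
    by (auto simp: D_def N_def M_def den_def num_def row_eq v_real P_real intro!: sum.cong)
  have resi: "res v (X i) i = 0" by (simp add: res_def)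
  have supp: "res v (X i) j = 0" if "v j = 0" for j using that by (simp add: res_def)
  \<comment> \<open>The resolvent identity for \<open>k = i\<close> at the node reads 0 = E_i N -
    C_i D. It makes the third and fourth cases contradictory.\<close>
  consider "D = 0" "N = 0" | "i < l" "D \<noteq> 0" | "i < l" "D = 0" "N \<noteq> 0" | "l \<le> i" "D \<noteq> 0"
    | "l \<le> i" "D = 0" "N \<noteq> 0" by linarith
  then show ?thesis
  proof cases
    case 1
    have zero: "mvec n P (res v (X i)) k = 0" if "k < n" "k \<noteq> i" for k
      by (rule cancel[OF _ that]) (use rowk[OF that(1)] 1 in simp)
    have "M \<noteq> 0"
    proof
      assume "M = 0"
      then have "ker (res v (X i))" using zero by (force simp: ker_def M_def row_def)
      then show False using no_common_zero[OF off] 1 by (simp add: D_def N_def)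
    qed
    \<comment> \<open>The resolvent vector has entry 0 at \<open>i\<close>, so its form is 0, while
      \<open>M\<close> cannot vanish without a common zero of \<open>den v\<close> and
      \<open>num v\<close>.\<close>
    then have "failure_witness i (res v (X i)) M"
      using vi supp zero resi by (auto simp: failure_witness_def M_def row_def)
    then show ?thesis by blast
  next
    case 2
    \<comment> \<open>Since N = w_i D, the rescaled resolvent vector and the unit vector have the
      same image under \<open>P\<close> off \<open>i\<close>. At \<open>i\<close> the images are the
      actual slope d = M / D and \<gamma>; failure means that the first is larger.\<close>
    define g where "g = (\<lambda>j. inverse D * res v (X i) j - unit i j)"
    have N: "N = complex_of_real (w i) * D" using rowk[OF i] 2 by (simp add: nE_def nC_def)
    have g: "mvec n P g k = inverse D * mvec n P (res v (X i)) k - P k i" for k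
      unfolding g_def mvec_diff mvec_scale mvec_unit[OF i] ..
    have zero: "mvec n P g k = 0" if k: "k < n" "k \<noteq> i" for k
    proof (rule cancel[OF _ k])
      have "(X i - X k) * mvec n P g k = inverse D * ((X i - X k) * mvec n P (res v (X i)) k) - (X i - X k) * P k i"
        unfolding g by (simp add: right_diff_distrib mult_ac)
      also have "\<dots> = 0"
        unfolding rowk[OF k(1)] Pki[OF k(1)] N using 2 by (simp add: nE_def nC_def field_simps)
      finally show "(X i - X k) * mvec n P g k = (X i - X k) * 0" by simp
    qed
    define d where "d = Re (M / D)"
    have d: "M / D = complex_of_real d"
      using reals unfolding d_def by (metis complex_cnj_divide Reals_cnj_iff of_real_Re)
    have "((\<lambda>z. row i z / den v z) \<longlongrightarrow> complex_of_real d) (at (X i))"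
      unfolding d[symmetric] by (intro tendsto_divide limM limD 2)
    then have gt: "d > \<gamma> i" using regular_node_slope[OF 2(1)] fail by force
    have \<beta>: "mvec n P g i = complex_of_real (d - \<gamma> i)"
      unfolding g using P_diag[OF i] 2 d by (simp add: M_def row_def divide_inverse mult.commute)
    have "g i = - 1" by (simp add: g_def resi unit_def)
    moreover have "g j = 0" if "j \<noteq> i" "v j = 0" for j
      using that by (simp add: g_def supp unit_def)
    ultimately have "failure_witness i g (complex_of_real (d - \<gamma> i))"
      using vi zero \<beta> gt unfolding failure_witness_def by auto
    then show ?thesis by blast
  next
    case 3
    then show ?thesis using rowk[OF i] by (simp add: nE_def nC_def)
  next
    case 4
    then show ?thesis using rowk[OF i] \<xi>_nonzero[OF _ i] by (simp add: nE_def nC_def)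
  next
    case 5
    have \<xi>i: "\<xi> i \<noteq> 0" using \<xi>_nonzero 5 i by auto
    define g where "g = (\<lambda>j. complex_of_real (\<xi> i) / N * res v (X i) j - unit i j)"
    have g: "mvec n P g k = complex_of_real (\<xi> i) / N * mvec n P (res v (X i)) k - P k i" for k
      unfolding g_def mvec_diff mvec_scale mvec_unit[OF i] ..
    have zero: "mvec n P g k = 0" if k: "k < n" "k \<noteq> i" for k
    proof (rule cancel[OF _ k])
      have "(X i - X k) * mvec n P g k
          = complex_of_real (\<xi> i) / N * ((X i - X k) * mvec n P (res v (X i)) k) - (X i - X k) * P k i"
        unfolding g by (simp add: right_diff_distrib mult_ac)
      also have "\<dots> = 0"
        unfolding rowk[OF k(1)] Pki[OF k(1)] using 5 by (simp add: nE_def nC_def)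
      finally show "(X i - X k) * mvec n P g k = (X i - X k) * 0" by simp
    qed
    \<comment> \<open>This is -1 divided by the limit of (z - x_i) times \<open>sol\<close>, with q
      = 0 when that limit is infinite; so failure means q > -1/\<xi>.\<close>
    define q where "q = Re (M / (complex_of_real (\<xi> i) * N))"
    have q: "M / (complex_of_real (\<xi> i) * N) = complex_of_real q"
      using reals unfolding q_def
      by (metis complex_cnj_divide complex_cnj_mult complex_cnj_complex_of_real Reals_cnj_iff of_real_Re)
    then have Mq: "M = complex_of_real (q * \<xi> i) * N"
      using 5 \<xi>i by (simp add: divide_eq_eq)
    have ev: "eventually (\<lambda>z. - complex_of_real (\<xi> i) * num v z / row i z = (z - X i) * sol z \<and> row i z \<noteq> 0) (at (X i))"
      using eventually_off_nodes[of "X i"] eventually_den_nonzero[of "X i"]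
    proof eventually_elim
      case (elim z)
      have eq: "(z - X i) * row i z = - complex_of_real (\<xi> i) * den v z"
        using row_identity[OF elim(1) i] 5 by (simp add: nE_def nC_def)
      then have ne: "row i z \<noteq> 0" using elim(2) \<xi>i by auto
      have "- complex_of_real (\<xi> i) * num v z * den v z = (z - X i) * row i z * num v z"
        unfolding eq by simp
      then show ?case using ne elim(2) by (simp add: sol_def divide_simps)
    qed
    have gt: "q > - 1 / \<xi> i"
    proof (rule ccontr)
      assume le: "\<not> ?thesis"
      have "interpolates_at l x w \<gamma> \<xi> sol i"
      proof (cases "M = 0")
        case True
        have "filterlim (row i) (at 0) (at (X i))"
          unfolding filterlim_at using limM True ev by (auto elim: eventually_mono)
        then have "filterlim (\<lambda>z. - complex_of_real (\<xi> i) * num v z / row i z) at_infinity (at (X i))"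
          using 5 \<xi>i by (intro filterlim_divide_at_infinity[where c = "- complex_of_real (\<xi> i) * N"] tendsto_intros limN) auto
        then have "filterlim (\<lambda>z. (z - X i) * sol z) at_infinity (at (X i))"
          by (rule filterlim_mono_eventually[OF _ order_refl order_refl]) (use ev in \<open>auto elim: eventually_mono\<close>)
        from nontangential_limit_at[OF this] show ?thesis
          using 5 le Mq True \<xi>i by (auto simp: interpolates_at_def)
      next
        case False
        then have q0: "q \<noteq> 0" using Mq by auto
        have "((\<lambda>z. - complex_of_real (\<xi> i) * num v z / row i z) \<longlongrightarrow> - complex_of_real (\<xi> i) * N / M) (at (X i))"
          by (intro tendsto_intros limN limM False)
        moreover have "- complex_of_real (\<xi> i) * N / M = complex_of_real (- 1 / q)"
          using Mq 5 \<xi>i q0 by (simp add: divide_simps)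
        ultimately have "((\<lambda>z. - complex_of_real (\<xi> i) * num v z / row i z) \<longlongrightarrow> complex_of_real (- 1 / q)) (at (X i))"
          by simp
        then have "((\<lambda>z. (z - X i) * sol z) \<longlongrightarrow> complex_of_real (- 1 / q)) (at (X i))"
          by (rule Lim_transform_eventually) (use ev in \<open>auto elim: eventually_mono\<close>)
        from nontangential_limit_at[OF this] show ?thesis
          using 5 le q0 by (auto simp: interpolates_at_def intro!: exI[of _ "- 1 / q"])
      qed
      then show False using fail by simp
    qed
    have \<beta>: "mvec n P g i = complex_of_real ((\<xi> i)\<^sup>2 * q + \<xi> i)"
      unfolding g using P_diag[OF i] 5 Mq by (simp add: M_def row_def power2_eq_square)
    have "(\<xi> i)\<^sup>2 * (q + 1 / \<xi> i) > 0"
      using gt \<xi>i by (intro mult_pos_pos) auto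
    then have pos: "(\<xi> i)\<^sup>2 * q + \<xi> i > 0"
      using \<xi>i by (simp add: distrib_left power2_eq_square)
    have "g i = - 1" by (simp add: g_def resi unit_def)
    moreover have "g j = 0" if "j \<noteq> i" "v j = 0" for j
      using that by (simp add: g_def supp unit_def)
    moreover have "complex_of_real ((\<xi> i)\<^sup>2 * q + \<xi> i) \<noteq> 0"
      using pos unfolding of_real_eq_0_iff by linarith
    ultimately have "failure_witness i g (complex_of_real ((\<xi> i)\<^sup>2 * q + \<xi> i))"
      using vi zero \<beta> pos unfolding failure_witness_def by (auto simp del: of_real_add of_real_mult)
    then show ?thesis by blast
  qed
qed

lemma sol_master: "master_solution n l x w \<gamma> \<xi> sol"
proof -
  let ?\<kappa> = "pick_index n l x w \<gamma> \<xi>"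
  define F where "F = {i. i < n \<and> \<not> interpolates_at l x w \<gamma> \<xi> sol i}"
  have "\<exists>g \<beta>. failure_witness i g \<beta>" if "i \<in> F" for i
    using that failure_at interpolates_on_support by (auto simp: F_def)
  then obtain g \<beta> where wit: "\<And>i. i \<in> F \<Longrightarrow> failure_witness i (g i) (\<beta> i)" by metis
  have F: "F \<subseteq> {..<n}" by (auto simp: F_def)
  \<comment> \<open>Membership in a generalised Nevanlinna class needs the exact index. It is taken
    as the maximum of this set, which is finite because it is bounded by the Pick index.\<close>
  let ?S = "{sq_neg (kernel_mat sol m z) | m z. m \<ge> 1 \<and> (\<forall>i<m. z i \<in> analyticity_domain sol)}"
  have bound: "s + card F \<le> ?\<kappa>" if "s \<in> ?S" for s
    using that sol_index_bound[OF _ F wit] by auto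
  obtain z0 where z0: "z0 \<in> analyticity_domain sol"
  proof -
    have "open {z. Im z > 0}" by (simp add: open_halfspace_Im_gt)
    then have "eventually (\<lambda>z. z \<in> {z. Im z > 0}) (at \<i>)"
      by (intro eventually_at_in_open') auto
    with eventually_den_nonzero[of \<i>]
    have "eventually (\<lambda>z. z \<in> analyticity_domain sol) (at \<i>)"
      by eventually_elim (simp add: sol_domain)
    then show thesis using that eventually_happens[of _ "at \<i>"] by auto
  qed
  have "sq_neg (kernel_mat sol 1 (\<lambda>_. z0)) \<in> ?S" using z0 by blast
  then have ne: "?S \<noteq> {}" by blast
  have "?S \<subseteq> {..?\<kappa>}"
  proof
    fix s assume "s \<in> ?S"
    from bound[OF this] show "s \<in> {..?\<kappa>}" by simp
  qed
  then have fin: "finite ?S" by (rule finite_subset) simp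
  define \<kappa>' where "\<kappa>' = Max ?S"
  have max: "\<kappa>' \<in> ?S" unfolding \<kappa>'_def using fin ne by (rule Max_in)
  have le: "s \<le> \<kappa>'" if "s \<in> ?S" for s unfolding \<kappa>'_def using fin that by (rule Max_ge)
  have gen: "sol \<in> gen_nevanlinna \<kappa>'"
    unfolding gen_nevanlinna_def using sol_nicely_meromorphic max le by blast
  \<comment> \<open>The exceptional set must have an exact size, so the set \<open>F\<close> of
    failures is padded by further nodes; this bound ensures that enough nodes exist.\<close>
  have \<kappa>n: "?\<kappa> \<le> n"
  proof -
    obtain d :: "nat \<Rightarrow> real" where "sq_neg (fun_mat n P) = card {k. k < n \<and> d k < 0}"
      by (rule hermitian_diagonalization[OF P_hermitian]) (rule that)
    also have "\<dots> \<le> card {..<n}" by (intro card_mono) auto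
    finally show ?thesis by (simp add: pick_index_eq)
  qed
  have "card F \<le> ?\<kappa> - \<kappa>'" using bound[OF max] by simp
  moreover have "?\<kappa> - \<kappa>' \<le> card {..<n}" using \<kappa>n by simp
  ultimately obtain E where "F \<subseteq> E" "E \<subseteq> {..<n}" "card E = ?\<kappa> - \<kappa>'"
    using exists_subset_between[of F "?\<kappa> - \<kappa>'" "{..<n}"] F by auto
  then show ?thesis
    unfolding master_solution_def using gen bound[OF max]
    by (intro exI[of _ \<kappa>'] conjI exI[of _ E]) (auto simp: F_def)
qed

end

section \<open>Boundary limits of kernel matrices\<close>

text \<open>Negative squares cannot increase in the limit: a family negative for \<open>A\<close>
  with margin \<delta> stays negative for a nearby scaled kernel matrix \<open>Ak k\<close>.
  Multiplying its vectors by \<open>fac k\<close> moves it to the kernel matrix itself. Vanishing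
  factors do no harm, since a negative value of the form excludes a zero image.\<close>

lemma sq_neg_limit_kernel:
  fixes A :: "nat \<Rightarrow> nat \<Rightarrow> complex" and pt fac :: "nat \<Rightarrow> nat \<Rightarrow> complex"
  assumes herm: "hermitian m A"
    and lim: "\<And>i j. i < m \<Longrightarrow> j < m \<Longrightarrow>
      (\<lambda>k. cnj (fac k i) * fac k j * nevanlinna_kernel h (pt k j) (pt k i)) \<longlonglongrightarrow> A i j"
    and bound: "eventually (\<lambda>k. sq_neg (kernel_mat h m (pt k)) \<le> \<kappa>) sequentially"
  shows "sq_neg (fun_mat m A) \<le> \<kappa>"
proof (rule sq_neg_negative_family[OF herm])
  fix I :: "nat set" and p :: "nat \<Rightarrow> nat \<Rightarrow> complex" and \<delta> :: real
  assume I: "finite I" "card I = sq_neg (fun_mat m A)" and \<delta>: "\<delta> > 0"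
    and neg: "\<And>c y. (\<And>i. i < m \<Longrightarrow> y i = (\<Sum>k\<in>I. p k i * c k)) \<Longrightarrow>
      Re (herm_form m A y y) \<le> - \<delta> * (\<Sum>k\<in>I. (cmod (c k))\<^sup>2)"
  define Ak where "Ak = (\<lambda>k i j. cnj (fac k i) * fac k j * nevanlinna_kernel h (pt k j) (pt k i))"
  \<comment> \<open>The entrywise distance of \<open>Ak k\<close> from \<open>A\<close>. By
    Cauchy-Schwarz, \<eta> k * B bounds the change of the form relative to the squared norm of the
    coefficients.\<close>
  define \<eta> where "\<eta> = (\<lambda>k. \<Sum>i<m. \<Sum>j<m. cmod (Ak k i j - A i j))"
  define M where "M = (\<lambda>s. \<Sum>i<m. cmod (p s i))"
  define B where "B = (\<Sum>s\<in>I. (M s)\<^sup>2)"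
  have B0: "B \<ge> 0" unfolding B_def by (simp add: sum_nonneg)
  have "\<eta> \<longlonglongrightarrow> (\<Sum>i<m. \<Sum>j<m. cmod (A i j - A i j))"
    unfolding \<eta>_def Ak_def by (intro tendsto_intros lim) auto
  then have "(\<lambda>k. \<eta> k * B) \<longlonglongrightarrow> 0 * B" by (intro tendsto_intros) simp
  then have "eventually (\<lambda>k. \<eta> k * B < \<delta>) sequentially"
    using \<delta> by (intro order_tendstoD(2)) auto
  with bound have "eventually (\<lambda>k. \<eta> k * B < \<delta> \<and> sq_neg (kernel_mat h m (pt k)) \<le> \<kappa>) sequentially"
    by eventually_elim simp
  then obtain k where k: "\<eta> k * B < \<delta>" "sq_neg (kernel_mat h m (pt k)) \<le> \<kappa>"
    using eventually_happens'[OF sequentially_bot] by blast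
  let ?K = "\<lambda>i j. nevanlinna_kernel h (pt k j) (pt k i)"
  have "card I \<le> card ({} :: nat set) + sq_neg (fun_mat m ?K)"
  proof (rule card_le_sq_neg[OF hermitian_nevanlinna_kernel, where Y = "\<lambda>s i. fac k i * p s i"])
    fix c z
    assume c: "\<exists>s\<in>I. c s \<noteq> 0" and z: "\<And>i. z i = (\<Sum>s\<in>I. fac k i * p s i * c s)"
    define y where "y = (\<lambda>i. \<Sum>s\<in>I. p s i * c s)"
    define T where "T = (\<Sum>s\<in>I. (cmod (c s))\<^sup>2)"
    have zy: "z i = fac k i * y i" for i
      unfolding z y_def sum_distrib_left by (simp add: mult.assoc)
    have T: "T > 0"
    proof -
      obtain s where "s \<in> I" "c s \<noteq> 0" using c by blast
      then show ?thesis unfolding T_def using I(1) by (intro sum_pos2[of I s]) auto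
    qed
    have form: "herm_form m ?K z z = herm_form m (Ak k) y y"
      unfolding herm_form_def mvec_def sum_distrib_left
      by (intro sum.cong refl) (simp add: zy Ak_def)
    have diff: "herm_form m (Ak k) y y - herm_form m A y y
        = (\<Sum>i<m. \<Sum>j<m. cnj (y i) * (Ak k i j - A i j) * y j)"
      unfolding herm_form_def mvec_def sum_distrib_left sum_subtractf[symmetric]
      by (intro sum.cong refl) (simp add: algebra_simps)
    have ysum: "(\<Sum>i<m. cmod (y i)) \<le> (\<Sum>s\<in>I. M s * cmod (c s))"
    proof -
      have "(\<Sum>i<m. cmod (y i)) \<le> (\<Sum>i<m. \<Sum>s\<in>I. cmod (p s i) * cmod (c s))"
        unfolding y_def by (intro sum_mono order_trans[OF norm_sum]) (simp add: norm_mult)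
      also have "\<dots> = (\<Sum>s\<in>I. M s * cmod (c s))"
        by (subst sum.swap) (simp add: M_def sum_distrib_right)
      finally show ?thesis .
    qed
    have "cmod (y i) \<le> (\<Sum>i<m. cmod (y i))" if "i < m" for i
      using that by (intro member_le_sum) auto
    then have y_le: "cmod (y i) \<le> (\<Sum>s\<in>I. M s * cmod (c s))" if "i < m" for i
      using ysum that order_trans by blast
    have "cmod (herm_form m (Ak k) y y - herm_form m A y y)
        \<le> (\<Sum>i<m. \<Sum>j<m. cmod (Ak k i j - A i j) * (\<Sum>s\<in>I. M s * cmod (c s))\<^sup>2)"
      unfolding diff
    proof (intro order_trans[OF norm_sum] sum_mono)
      fix i j assume ij: "i \<in> {..<m}" "j \<in> {..<m}"
      have "cmod (y i) * cmod (y j) \<le> (\<Sum>s\<in>I. M s * cmod (c s)) * (\<Sum>s\<in>I. M s * cmod (c s))"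
        using ij by (intro mult_mono y_le sum_nonneg mult_nonneg_nonneg) (auto simp: M_def sum_nonneg)
      then have "cmod (Ak k i j - A i j) * (cmod (y i) * cmod (y j))
          \<le> cmod (Ak k i j - A i j) * (\<Sum>s\<in>I. M s * cmod (c s))\<^sup>2"
        unfolding power2_eq_square by (intro mult_left_mono) auto
      then show "cmod (cnj (y i) * (Ak k i j - A i j) * y j)
          \<le> cmod (Ak k i j - A i j) * (\<Sum>s\<in>I. M s * cmod (c s))\<^sup>2"
        by (simp add: norm_mult mult_ac)
    qed
    also have "\<dots> = \<eta> k * (\<Sum>s\<in>I. M s * cmod (c s))\<^sup>2"
      by (simp add: \<eta>_def sum_distrib_right)
    also have "\<dots> \<le> \<eta> k * (B * T)"
      unfolding B_def T_def
      by (intro mult_left_mono Cauchy_Schwarz_ineq_sum) (simp add: \<eta>_def sum_nonneg)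
    also have "\<dots> < \<delta> * T" using k(1) T by (simp flip: mult.assoc)
    finally have "cmod (herm_form m (Ak k) y y - herm_form m A y y) < \<delta> * T" .
    moreover have "Re (herm_form m A y y) \<le> - \<delta> * T"
      unfolding T_def by (rule neg) (simp add: y_def)
    ultimately have less: "Re (herm_form m ?K z z) < 0"
      using complex_Re_le_cmod[of "herm_form m (Ak k) y y - herm_form m A y y"] form by simp
    moreover have "\<exists>i<m. mvec m ?K z i \<noteq> 0"
    proof (rule ccontr)
      assume "\<not> ?thesis"
      then have "herm_form m ?K z z = 0" by (auto simp: herm_form_def intro!: sum.neutral)
      then show False using less by simp
    qed
    ultimately show "Re (herm_form m ?K z z) \<le> 0 \<and> (\<exists>i<m. mvec m ?K z i \<noteq> 0)" by simp
  qed (use I in auto)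
  then show ?thesis using I k(2) by (simp add: kernel_mat_def)
qed

section \<open>Vertical approach to boundary points\<close>

definition vert :: "real \<Rightarrow> nat \<Rightarrow> complex" where
  "vert x k = Complex x (1 / real (Suc k))"

lemma vert_tendsto: "vert x \<longlonglongrightarrow> complex_of_real x"
proof -
  have "(\<lambda>k. complex_of_real x + \<i> * complex_of_real (1 / real (Suc k))) \<longlonglongrightarrow>
      complex_of_real x + \<i> * complex_of_real 0"
    using LIMSEQ_inverse_real_of_nat by (intro tendsto_intros) (simp add: inverse_eq_divide)
  then show ?thesis by (simp add: vert_def[abs_def] Complex_eq)
qed

lemma vert_filterlim: "filterlim (vert x) (at (complex_of_real x) within stolz_angle x 1) sequentially"
  unfolding filterlim_at using vert_tendsto
  by (auto simp: vert_def stolz_angle_def complex_eq_iff intro!: always_eventually)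

lemma nontangential_limitD:
  assumes "nontangential_limit f F x"
  shows "filterlim f F (at (complex_of_real x) within stolz_angle x 1)"
  using assms unfolding nontangential_limit_def by (elim allE[of _ 1]) simp

lemma nontangential_limit_vert:
  assumes "nontangential_limit f F x"
  shows "filterlim (\<lambda>k. f (vert x k)) F sequentially"
  by (rule filterlim_compose[OF nontangential_limitD[OF assms] vert_filterlim])

lemma open_stolz_angle: "open (stolz_angle x a)"
proof -
  have "stolz_angle x a = {z. 0 < Im z} \<inter> {z. \<bar>Re z - x\<bar> < a * Im z}"
    by (auto simp: stolz_angle_def)
  moreover have "open {z. \<bar>Re z - x\<bar> < a * Im z}" by (intro open_Collect_less continuous_intros)
  ultimately show ?thesis by (simp add: open_halfspace_Im_gt open_Int)
qed

text \<open>Since the Stolz angle is open, a property holding in it near the vertex holds on a full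
  neighbourhood of each of its points near the vertex. This converts nontangential bounds into
  statements about poles.\<close>

lemma eventually_stolz_local:
  assumes "eventually Q (at (complex_of_real x) within stolz_angle x a)"
  shows "eventually (\<lambda>z. z \<in> stolz_angle x a \<and> eventually Q (nhds z))
    (at (complex_of_real x) within stolz_angle x a)"
proof -
  obtain d where d: "d > 0"
    "\<And>z. z \<in> stolz_angle x a \<Longrightarrow> z \<noteq> complex_of_real x \<Longrightarrow> dist z (complex_of_real x) < d \<Longrightarrow> Q z"
    using assms unfolding eventually_at by blast
  have "eventually Q (nhds z)"
    if "z \<in> stolz_angle x a" "dist z (complex_of_real x) < d" for z
  proof -
    have "open (stolz_angle x a \<inter> ball (complex_of_real x) d)"
      by (intro open_Int open_stolz_angle open_ball)
    then have "eventually (\<lambda>u. u \<in> stolz_angle x a \<inter> ball (complex_of_real x) d) (nhds z)"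
      using that by (intro eventually_nhds_in_open) (auto simp: dist_commute)
    then show ?thesis
    proof eventually_elim
      case (elim u)
      then have "u \<noteq> complex_of_real x" by (auto simp: stolz_angle_def)
      then show ?case using elim d(2)[of u] by (simp add: dist_commute)
    qed
  qed
  then show ?thesis unfolding eventually_at using d(1) by blast
qed

lemma bounded_multiple_no_pole:
  fixes q h :: "complex \<Rightarrow> complex"
  assumes q: "isCont q z" "q z \<noteq> 0" and bnd: "eventually (\<lambda>u. cmod (q u * h u) \<le> b) (at z)"
  shows "\<not> is_pole h z"
proof
  assume "is_pole h z"
  then have "filterlim (\<lambda>u. q u * h u) at_infinity (at z)"
    using q by (intro tendsto_mult_filterlim_at_infinity[of _ "q z"]) (auto simp: is_pole_def isCont_def)
  then have "eventually (\<lambda>u. cmod (q u * h u) \<ge> \<bar>b\<bar> + 1) (at z)"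
    by (subst (asm) filterlim_at_infinity[of 0]) auto
  with bnd have "eventually (\<lambda>u. False) (at z)" by eventually_elim auto
  then show False by (simp add: eventually_False)
qed

text \<open>The factor \<open>q\<close> is 1 at a regular node and z - x at a singular one. A finite
  limit bounds \<open>q z * h z\<close> and so excludes poles.\<close>

lemma eventually_stolz_analytic:
  assumes h: "h nicely_meromorphic_on {z. Im z > 0}"
    and lim: "(\<exists>c. nontangential_limit (\<lambda>z. q z * h z) (nhds c) x) \<or>
      nontangential_limit (\<lambda>z. q z * h z) at_infinity x"
    and q: "\<And>z. isCont q z" "\<And>z. Im z > 0 \<Longrightarrow> q z \<noteq> 0"
  shows "eventually (\<lambda>z. h analytic_on {z}) (at (complex_of_real x) within stolz_angle x 1)"
proof -
  let ?F = "at (complex_of_real x) within stolz_angle x 1"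
  have "eventually (\<lambda>z. z \<in> stolz_angle x 1 \<and> \<not> is_pole h z) ?F"
    using lim
  proof
    assume "\<exists>c. nontangential_limit (\<lambda>z. q z * h z) (nhds c) x"
    then obtain c where "((\<lambda>z. q z * h z) \<longlongrightarrow> c) ?F" using nontangential_limitD by blast
    then have "eventually (\<lambda>z. dist (q z * h z) c < 1) ?F" by (rule tendstoD) simp
    then have "eventually (\<lambda>z. z \<in> stolz_angle x 1 \<and> eventually (\<lambda>u. dist (q u * h u) c < 1) (nhds z)) ?F"
      by (rule eventually_stolz_local)
    then show ?thesis
    proof eventually_elim
      case (elim z)
      then have "eventually (\<lambda>u. dist (q u * h u) c < 1) (at z)"
        by (auto simp: eventually_at_filter elim: eventually_mono)
      then have "eventually (\<lambda>u. cmod (q u * h u) \<le> cmod c + 1) (at z)"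
      proof eventually_elim
        case (elim u)
        then show ?case using norm_triangle_ineq2[of "q u * h u" c] by (simp add: dist_norm)
      qed
      from bounded_multiple_no_pole[OF q(1) _ this] q(2)[of z]
      show ?case using elim by (auto simp: stolz_angle_def)
    qed
  next
    assume "nontangential_limit (\<lambda>z. q z * h z) at_infinity x"
    then have "filterlim (\<lambda>z. q z * h z) at_infinity ?F" by (rule nontangential_limitD)
    then have "eventually (\<lambda>z. cmod (q z * h z) \<ge> 1) ?F"
      by (subst (asm) filterlim_at_infinity[of 0]) auto
    moreover have "eventually (\<lambda>z. z \<in> stolz_angle x 1) ?F" by (simp add: eventually_at_filter)
    ultimately show ?thesis
    proof eventually_elim
      case (elim z)
      \<comment> \<open>For an infinite limit the normal form is essential: the value at a pole
        would be 0, contradicting the lower bound on the product.\<close>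
      then have "h z \<noteq> 0" by auto
      then have "h \<midarrow>z\<rightarrow> h z" using h elim by (auto simp: nicely_meromorphic_on_def stolz_angle_def)
      then show ?case using elim not_tendsto_and_filterlim_at_infinity[of "at z" h "h z"]
        by (auto simp: is_pole_def)
    qed
  qed
  then show ?thesis
    by eventually_elim (auto simp: stolz_angle_def intro: nicely_meromorphic_on_imp_analytic_at[OF h])
qed

text \<open>Integrating the bound on \<open>h' - d\<close> along the vertical segment turns the nontangential limit of
  the derivative into the limit of the difference quotient at the boundary point.\<close>

lemma vert_difference_quotient:
  assumes ana: "eventually (\<lambda>z. h analytic_on {z}) (at (complex_of_real x) within stolz_angle x 1)"
    and c: "nontangential_limit h (nhds c) x" and d: "nontangential_limit (deriv h) (nhds d) x"
  shows "(\<lambda>k. (h (vert x k) - c) / (vert x k - complex_of_real x)) \<longlonglongrightarrow> d"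
proof (rule tendstoI)
  fix \<epsilon> :: real assume \<epsilon>: "\<epsilon> > 0"
  let ?F = "at (complex_of_real x) within stolz_angle x 1"
  have "(deriv h \<longlongrightarrow> d) ?F" using d by (rule nontangential_limitD)
  then have "eventually (\<lambda>z. dist (deriv h z) d < \<epsilon> / 2) ?F" using \<epsilon> by (intro tendstoD) auto
  with ana have "eventually (\<lambda>z. h analytic_on {z} \<and> dist (deriv h z) d < \<epsilon> / 2) ?F"
    by eventually_elim simp
  then obtain r where r: "r > 0" and near: "\<And>z. z \<in> stolz_angle x 1 \<Longrightarrow> z \<noteq> complex_of_real x \<Longrightarrow>
      dist z (complex_of_real x) < r \<Longrightarrow> h analytic_on {z} \<and> dist (deriv h z) d < \<epsilon> / 2"
    unfolding eventually_at by blast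
  \<comment> \<open>The open vertical segment above \<open>x\<close>, written as an intersection of
    half planes so that convexity is immediate.\<close>
  define V where "V = {z. Re z \<ge> x} \<inter> {z. Re z \<le> x} \<inter> {z. Im z > 0} \<inter> {z. Im z < r}"
  have V: "convex V" unfolding V_def
    by (intro convex_Int convex_halfspace_Re_ge convex_halfspace_Re_le convex_halfspace_Im_gt convex_halfspace_Im_lt)
  have nearV: "h analytic_on {z}" "cmod (deriv h z - d) \<le> \<epsilon> / 2" if "z \<in> V" for z
  proof -
    have z: "Re z = x" "Im z > 0" "Im z < r" using that by (auto simp: V_def)
    then have "z - complex_of_real x = \<i> * complex_of_real (Im z)" by (simp add: complex_eq_iff)
    then have "dist z (complex_of_real x) < r" using z by (simp add: dist_norm norm_mult)
    moreover have "z \<noteq> complex_of_real x"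
    proof
      assume "z = complex_of_real x"
      then have "Im z = 0" by simp
      with z show False by simp
    qed
    ultimately show "h analytic_on {z}" "cmod (deriv h z - d) \<le> \<epsilon> / 2"
      using near[of z] z by (auto simp: stolz_angle_def dist_norm)
  qed
  have lip: "cmod ((h a - d * a) - (h b - d * b)) \<le> \<epsilon> / 2 * cmod (a - b)" if "a \<in> V" "b \<in> V" for a b
  proof (rule field_differentiable_bound[OF V, of "\<lambda>z. h z - d * z" "\<lambda>z. deriv h z - d"])
    fix z assume z: "z \<in> V"
    have "h field_differentiable (at z)"
      by (rule analytic_on_imp_differentiable_at[OF nearV(1)[OF z]]) simp
    then have "(h has_field_derivative deriv h z) (at z)"
      by (simp only: DERIV_deriv_iff_field_differentiable)
    from DERIV_diff[OF this DERIV_cmult_Id[of d]]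
    show "((\<lambda>z. h z - d * z) has_field_derivative deriv h z - d) (at z within V)"
      by (rule has_field_derivative_at_within)
  qed (use nearV(2) that in simp_all)
  have evV: "eventually (\<lambda>k. vert x k \<in> V) sequentially"
  proof -
    have "eventually (\<lambda>k. dist (vert x k) (complex_of_real x) < r) sequentially"
      using vert_tendsto r by (rule tendstoD)
    then show ?thesis
    proof eventually_elim
      case (elim k)
      then have "\<bar>Im (vert x k - complex_of_real x)\<bar> < r"
        using abs_Im_le_cmod order_le_less_trans unfolding dist_norm by blast
      then show ?case by (simp add: V_def vert_def)
    qed
  qed
  show "eventually (\<lambda>k. dist ((h (vert x k) - c) / (vert x k - complex_of_real x)) d < \<epsilon>) sequentially"
    using evV
  proof eventually_elim
    case (elim k)
    let ?z = "vert x k"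
    have hl: "(\<lambda>j. h (vert x j)) \<longlonglongrightarrow> c" by (rule nontangential_limit_vert[OF c])
    have "cmod ((h ?z - d * ?z) - (c - d * complex_of_real x)) \<le> \<epsilon> / 2 * cmod (?z - complex_of_real x)"
    \<comment> \<open>The second end point of the Lipschitz estimate moves down to the boundary,
      where \<open>h\<close> is replaced by its limit \<open>c\<close>.\<close>
    proof (rule tendsto_le[OF sequentially_bot])
      show "(\<lambda>j. \<epsilon> / 2 * cmod (?z - vert x j)) \<longlonglongrightarrow> \<epsilon> / 2 * cmod (?z - complex_of_real x)"
        by (intro tendsto_intros vert_tendsto)
      show "(\<lambda>j. cmod ((h ?z - d * ?z) - (h (vert x j) - d * vert x j))) \<longlonglongrightarrow>
          cmod ((h ?z - d * ?z) - (c - d * complex_of_real x))"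
        by (intro tendsto_intros hl vert_tendsto)
      show "eventually (\<lambda>j. cmod ((h ?z - d * ?z) - (h (vert x j) - d * vert x j))
          \<le> \<epsilon> / 2 * cmod (?z - vert x j)) sequentially"
        using evV by eventually_elim (rule lip[OF elim])
    qed
    moreover have ne: "?z - complex_of_real x \<noteq> 0" by (simp add: vert_def complex_eq_iff)
    moreover have "(h ?z - c) / (?z - complex_of_real x) - d
        = ((h ?z - d * ?z) - (c - d * complex_of_real x)) / (?z - complex_of_real x)"
      using ne by (simp add: divide_simps) (simp add: algebra_simps)
    ultimately have "cmod ((h ?z - c) / (?z - complex_of_real x) - d) \<le> \<epsilon> / 2"
      by (simp add: norm_divide divide_le_eq)
    then show ?case using \<epsilon> by (simp add: dist_norm)
  qed
qed

section \<open>The bordered limit matrix of a solution\<close>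

context pick_data
begin

text \<open>Scaling by \<phi> brings both kinds of node to one form: the pair (\<phi>, \<phi> h)
  tends to the data pair (E_i, C_i), and the scaled diagonal kernel value tends to some \<delta> not
  exceeding the diagonal entry of \<open>P\<close>.\<close>

definition node_approx :: "(complex \<Rightarrow> complex) \<Rightarrow> nat \<Rightarrow> (nat \<Rightarrow> complex) \<Rightarrow> real \<Rightarrow> bool" where
  "node_approx h i \<phi> \<delta> \<longleftrightarrow>
     \<phi> \<longlonglongrightarrow> complex_of_real (nE i) \<and>
     (\<lambda>k. \<phi> k * h (vert (x i) k)) \<longlonglongrightarrow> complex_of_real (nC i) \<and>
     (\<lambda>k. cnj (\<phi> k) * \<phi> k * nevanlinna_kernel h (vert (x i) k) (vert (x i) k)) \<longlonglongrightarrow> complex_of_real \<delta> \<and>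
     eventually (\<lambda>k. vert (x i) k \<in> analyticity_domain h) sequentially \<and>
     \<delta> \<le> Re (P i i)"

lemma node_approx_exists:
  assumes h: "h nicely_meromorphic_on {z. Im z > 0}"
    and i: "i < n" and int: "interpolates_at l x w \<gamma> \<xi> h i"
  shows "\<exists>\<phi> \<delta>. node_approx h i \<phi> \<delta>"
proof -
  define z where "z = vert (x i)"
  define \<epsilon> where "\<epsilon> = (\<lambda>k. complex_of_real (1 / real (Suc k)))"
  have \<epsilon>0: "\<epsilon> k \<noteq> 0" for k by (simp add: \<epsilon>_def del: of_nat_Suc)
  have cnj\<epsilon>: "cnj (\<epsilon> k) = \<epsilon> k" for k by (simp add: \<epsilon>_def)
  have zx: "z k - complex_of_real (x i) = \<i> * \<epsilon> k" for k
    by (simp add: z_def vert_def \<epsilon>_def complex_eq_iff)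
  have zz: "z k - cnj (z k) = 2 * \<i> * \<epsilon> k" for k
    by (simp add: z_def vert_def \<epsilon>_def complex_eq_iff)
  have \<epsilon>lim: "\<epsilon> \<longlonglongrightarrow> 0"
  proof -
    have "(\<lambda>k. 1 / real (Suc k)) \<longlonglongrightarrow> 0"
      using LIMSEQ_inverse_real_of_nat by (simp only: inverse_eq_divide)
    from tendsto_of_real[OF this] show ?thesis by (simp only: \<epsilon>_def of_real_0)
  qed
  have Imz: "Im (z k) > 0" for k by (simp add: z_def vert_def)
  show ?thesis
  proof (cases "i < l")
    case True
    from int True obtain d where
      c: "nontangential_limit h (nhds (complex_of_real (w i))) (x i)"
      and d: "nontangential_limit (deriv h) (nhds (complex_of_real d)) (x i)" "d \<le> \<gamma> i"
      by (auto simp: interpolates_at_def)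
    have ana: "eventually (\<lambda>z. h analytic_on {z}) (at (complex_of_real (x i)) within stolz_angle (x i) 1)"
      by (rule eventually_stolz_analytic[OF h, of "\<lambda>_. 1"]) (use c in auto)
    define q where "q = (\<lambda>k. (h (z k) - complex_of_real (w i)) / (z k - complex_of_real (x i)))"
    have q: "q \<longlonglongrightarrow> complex_of_real d"
      unfolding q_def z_def by (rule vert_difference_quotient[OF ana c d(1)])
    have hq: "h (z k) = complex_of_real (w i) + \<i> * \<epsilon> k * q k" for k
      using \<epsilon>0[of k] by (simp add: q_def zx)
    \<comment> \<open>On the vertical line the diagonal kernel value is the real part of the
      difference quotient, so it tends to the boundary derivative.\<close>
    have K: "nevanlinna_kernel h (z k) (z k) = (q k + cnj (q k)) / 2" for k
    proof -
      have "h (z k) - cnj (h (z k)) = (\<i> * \<epsilon> k) * (q k + cnj (q k))"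
        unfolding hq by (simp add: cnj\<epsilon> algebra_simps)
      then show ?thesis unfolding nevanlinna_kernel_def zz using \<epsilon>0[of k] by simp
    qed
    have "(\<lambda>k. nevanlinna_kernel h (z k) (z k)) \<longlonglongrightarrow> (complex_of_real d + cnj (complex_of_real d)) / 2"
      unfolding K by (intro tendsto_intros q) auto
    moreover have "(\<lambda>k. h (z k)) \<longlonglongrightarrow> complex_of_real (w i)"
      unfolding z_def by (rule nontangential_limit_vert[OF c])
    moreover have "eventually (\<lambda>k. z k \<in> analyticity_domain h) sequentially"
    proof -
      have "eventually (\<lambda>k. h analytic_on {z k}) sequentially"
        unfolding z_def using vert_filterlim ana by (auto simp: filterlim_iff)
      then show ?thesis by eventually_elim (use Imz in \<open>simp add: analyticity_domain_def\<close>)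
    qed
    ultimately have "node_approx h i (\<lambda>_. 1) d"
      using True d(2) P_diag[OF i] by (simp add: node_approx_def nE_def nC_def z_def)
    then show ?thesis by blast
  next
    case False
    have \<xi>i: "\<xi> i \<noteq> 0" using False i \<xi>_nonzero by simp
    let ?q = "\<lambda>z. (z - complex_of_real (x i)) * h z"
    have lims: "(\<exists>c. nontangential_limit ?q (nhds c) (x i)) \<or> nontangential_limit ?q at_infinity (x i)"
      using int False by (auto simp: interpolates_at_def)
    have ana: "eventually (\<lambda>z. h analytic_on {z}) (at (complex_of_real (x i)) within stolz_angle (x i) 1)"
      by (rule eventually_stolz_analytic[OF h lims]) (auto intro!: continuous_intros)
    define q where "q = (\<lambda>k. ?q (z k))"
    \<comment> \<open>The reciprocal limit \<rho> treats finite and infinite limits of (z - x_i)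
      h(z) together, with \<rho> = 0 in the infinite case.\<close>
    have "\<exists>\<rho>. (\<lambda>k. inverse (q k)) \<longlonglongrightarrow> complex_of_real \<rho> \<and> - \<rho> \<le> - 1 / \<xi> i \<and>
        eventually (\<lambda>k. q k \<noteq> 0) sequentially"
    proof -
      from int False consider r where "r \<noteq> 0" "nontangential_limit ?q (nhds (complex_of_real r)) (x i)"
          "- 1 / r \<le> - 1 / \<xi> i"
        | "nontangential_limit ?q at_infinity (x i)" "0 \<le> - 1 / \<xi> i"
        by (auto simp: interpolates_at_def)
      then show ?thesis
      proof cases
        case (1 r)
        have "q \<longlonglongrightarrow> complex_of_real r"
          unfolding q_def z_def by (rule nontangential_limit_vert[OF 1(2)])
        moreover from this have "eventually (\<lambda>k. q k \<noteq> 0) sequentially"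
          by (rule tendsto_imp_eventually_ne) (use 1 in simp)
        ultimately show ?thesis using 1
          by (intro exI[of _ "inverse r"]) (auto simp: inverse_eq_divide intro!: tendsto_intros)
      next
        case 2
        have inf: "filterlim q at_infinity sequentially"
          unfolding q_def z_def by (rule nontangential_limit_vert[OF 2(1)])
        then have "(\<lambda>k. inverse (q k)) \<longlonglongrightarrow> 0" by (rule tendsto_inverse_0[THEN filterlim_compose])
        moreover have "eventually (\<lambda>k. q k \<noteq> 0) sequentially"
          using inf by (rule filterlim_at_infinity_imp_eventually_ne)
        ultimately show ?thesis using 2 by (intro exI[of _ 0]) auto
      qed
    qed
    then obtain \<rho> where \<rho>: "(\<lambda>k. inverse (q k)) \<longlonglongrightarrow> complex_of_real \<rho>" "- \<rho> \<le> - 1 / \<xi> i"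
      and q0: "eventually (\<lambda>k. q k \<noteq> 0) sequentially" by blast
    \<comment> \<open>Where \<open>q k\<close> is nonzero this is \<xi> divided by
      \<open>h (z k)\<close>. It tends to 0 = E_i, while its product with \<open>h\<close> is
      eventually the constant \<xi> = C_i.\<close>
    define \<phi> where "\<phi> = (\<lambda>k. complex_of_real (\<xi> i) * (\<i> * \<epsilon> k * inverse (q k)))"
    have qk: "q k = \<i> * \<epsilon> k * h (z k)" for k by (simp add: q_def zx)
    have "\<phi> \<longlonglongrightarrow> complex_of_real (\<xi> i) * (\<i> * 0 * complex_of_real \<rho>)"
      unfolding \<phi>_def by (intro tendsto_intros \<epsilon>lim \<rho>)
    moreover have "(\<lambda>k. \<phi> k * h (z k)) \<longlonglongrightarrow> complex_of_real (\<xi> i)"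
    proof (rule tendsto_eventually)
      show "eventually (\<lambda>k. \<phi> k * h (z k) = complex_of_real (\<xi> i)) sequentially"
        using q0
      proof eventually_elim
        case (elim k)
        have "\<phi> k * h (z k) = complex_of_real (\<xi> i) * (q k * inverse (q k))"
          by (simp only: \<phi>_def qk mult_ac)
        then show ?case using elim by simp
      qed
    qed
    moreover have "(\<lambda>k. cnj (\<phi> k) * \<phi> k * nevanlinna_kernel h (z k) (z k)) \<longlonglongrightarrow>
        complex_of_real (- ((\<xi> i)\<^sup>2 * \<rho>))"
    proof -
      have "(\<lambda>k. - (complex_of_real ((\<xi> i)\<^sup>2) * (inverse (q k) + cnj (inverse (q k))) / 2)) \<longlonglongrightarrow>
          - (complex_of_real ((\<xi> i)\<^sup>2) * (complex_of_real \<rho> + cnj (complex_of_real \<rho>)) / 2)"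
        by (intro tendsto_intros \<rho>) auto
      then have "(\<lambda>k. - (complex_of_real ((\<xi> i)\<^sup>2) * (inverse (q k) + cnj (inverse (q k))) / 2)) \<longlonglongrightarrow>
          complex_of_real (- ((\<xi> i)\<^sup>2 * \<rho>))" by simp
      then show ?thesis
      proof (rule Lim_transform_eventually)
        show "eventually (\<lambda>k. - (complex_of_real ((\<xi> i)\<^sup>2) * (inverse (q k) + cnj (inverse (q k))) / 2)
            = cnj (\<phi> k) * \<phi> k * nevanlinna_kernel h (z k) (z k)) sequentially"
          using q0
        proof eventually_elim
          case (elim k)
          have h: "h (z k) = q k / (\<i> * \<epsilon> k)" using \<epsilon>0[of k] by (simp add: qk)
          show ?case unfolding nevanlinna_kernel_def zz h \<phi>_def using elim \<epsilon>0[of k]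
            by (simp add: cnj\<epsilon> field_simps power2_eq_square)
        qed
      qed
    qed
    moreover have "eventually (\<lambda>k. z k \<in> analyticity_domain h) sequentially"
    proof -
      have "eventually (\<lambda>k. h analytic_on {z k}) sequentially"
        unfolding z_def using vert_filterlim ana by (auto simp: filterlim_iff)
      then show ?thesis by eventually_elim (use Imz in \<open>simp add: analyticity_domain_def\<close>)
    qed
    moreover have "- ((\<xi> i)\<^sup>2 * \<rho>) \<le> - \<xi> i"
    proof -
      have "(\<xi> i)\<^sup>2 * - \<rho> \<le> (\<xi> i)\<^sup>2 * (- 1 / \<xi> i)" using \<rho>(2) by (intro mult_left_mono) auto
      then show ?thesis using \<xi>i by (simp add: power2_eq_square)
    qed
    ultimately have "node_approx h i \<phi> (- ((\<xi> i)\<^sup>2 * \<rho>))"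
      using False P_diag[OF i] by (simp add: node_approx_def nE_def nC_def z_def)
    then show ?thesis by blast
  qed
qed

text \<open>If no such \<open>u\<close> existed, every nontrivial combination of the nonpositive
  family of \<open>P\<close> that vanishes on \<open>E\<close> would be nonpositive with nonzero
  image for the limit matrix \<open>A\<close>. The family would then have at most
  \<open>card E\<close> + \<kappa>' members, which is the Pick index, but singularity of
  \<open>P\<close> supplies one more.\<close>

lemma solution_kernel_vector:
  fixes m :: nat and z :: "nat \<Rightarrow> complex"
  assumes h: "h \<in> gen_nevanlinna \<kappa>'" and E: "E \<subseteq> {..<n}"
    and card: "card E + \<kappa>' = pick_index n l x w \<gamma> \<xi>"
    and int: "\<And>i. i \<in> {..<n} - E \<Longrightarrow> interpolates_at l x w \<gamma> \<xi> h i"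
    and sing: "ker u0" "\<exists>i<n. u0 i \<noteq> 0"
    and z: "m > 0" "\<And>r. r < m \<Longrightarrow> z r \<in> analyticity_domain h"
  shows "\<exists>u. ker u \<and> (\<exists>i<n. u i \<noteq> 0) \<and> (\<forall>r<m. num u (z r) = h (z r) * den u (z r))"
proof (rule ccontr)
  assume contra: "\<not> ?thesis"
  have mero: "h nicely_meromorphic_on {z. Im z > 0}"
    and bound: "\<And>m z. m \<ge> 1 \<Longrightarrow> (\<forall>i<m. z i \<in> analyticity_domain h) \<Longrightarrow> sq_neg (kernel_mat h m z) \<le> \<kappa>'"
    using h by (auto simp: gen_nevanlinna_def)
  have "\<exists>\<phi> \<delta>. node_approx h i \<phi> \<delta>" if "i \<in> {..<n} - E" for i
    using node_approx_exists[OF mero _ int[OF that]] that by auto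
  then obtain \<phi> \<delta> where app: "\<And>i. i < n \<Longrightarrow> i \<notin> E \<Longrightarrow> node_approx h i (\<phi> i) (\<delta> i)"
    by (metis DiffI lessThan_iff)
  define N where "N = n + m"
  define node where "node = (\<lambda>j. j < n \<and> j \<notin> E)"
  \<comment> \<open>Slots below \<open>n\<close> stand for nodes and the last \<open>m\<close> for
    the points \<open>z\<close>. Exceptional nodes become dummies placed at \<open>z 0\<close> with
    weight 0, which keeps the indexing uniform and gives zero rows and columns.\<close>
  define fac where "fac = (\<lambda>k j. if node j then \<phi> j k else if j < n then 0 else 1)"
  define pt where "pt = (\<lambda>k j. if node j then vert (x j) k else if j < n then z 0 else z (j - n))"
  define e where "e = (\<lambda>j. if node j then complex_of_real (nE j) else if j < n then 0 else 1)"
  define c where "c = (\<lambda>j. if node j then complex_of_real (nC j) else if j < n then 0 else h (z (j - n)))"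
  define p where "p = (\<lambda>j. if node j then complex_of_real (x j) else if j < n then z 0 else z (j - n))"
  \<comment> \<open>On the diagonal at a good node the limiting quotient would be 0/0, so the limit
    \<delta> from \<open>node_approx\<close> is used instead.\<close>
  define A where "A = (\<lambda>i j. if i = j \<and> node i then complex_of_real (\<delta> i)
    else (cnj (e i) * c j - cnj (c i) * e j) / (p j - cnj (p i)))"
  have Imz: "Im (z r) > 0" if "r < m" for r using z(2)[OF that] by (simp add: analyticity_domain_def)
  have fac_lim: "(\<lambda>k. fac k j) \<longlonglongrightarrow> e j" for j
    using app[of j] by (auto simp: fac_def e_def node_def node_approx_def)
  have c_lim: "(\<lambda>k. fac k j * h (pt k j)) \<longlonglongrightarrow> c j" for j
    using app[of j] by (auto simp: fac_def c_def pt_def node_def node_approx_def)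
  have pt_lim: "(\<lambda>k. pt k j) \<longlonglongrightarrow> p j" for j
    using vert_tendsto[of "x j"] by (auto simp: pt_def p_def)
  have Imp: "Im (p j) \<ge> 0" "\<not> node j \<Longrightarrow> Im (p j) > 0" if "j < N" for j
    using that Imz z(1) by (auto simp: p_def N_def intro: less_imp_le)
  have p_ne: "p j - cnj (p i) \<noteq> 0" if "i < N" "j < N" "\<not> (i = j \<and> node i)" for i j
  proof (cases "node i \<and> node j")
    case True
    then show ?thesis using that x_eq_iff[of i j] by (auto simp: p_def node_def)
  next
    case False
    then have "Im (p j) + Im (p i) > 0" using Imp[OF that(1)] Imp[OF that(2)] by fastforce
    then have "Im (p j - cnj (p i)) \<noteq> 0" by simp
    then show ?thesis by (metis zero_complex.sel(2))
  qed
  have A_lim: "(\<lambda>k. cnj (fac k i) * fac k j * nevanlinna_kernel h (pt k j) (pt k i)) \<longlonglongrightarrow> A i j"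
    if ij: "i < N" "j < N" for i j
  proof (cases "i = j \<and> node i")
    case True
    then show ?thesis
      using app[of i] by (auto simp: A_def fac_def pt_def node_def node_approx_def)
  next
    case False
    have "(\<lambda>k. (cnj (fac k i) * (fac k j * h (pt k j)) - cnj (fac k i * h (pt k i)) * fac k j)
        / (pt k j - cnj (pt k i))) \<longlonglongrightarrow> (cnj (e i) * c j - cnj (c i) * e j) / (p j - cnj (p i))"
      by (intro tendsto_intros fac_lim c_lim pt_lim p_ne[OF ij False])
    moreover have "(cnj (fac k i) * (fac k j * h (pt k j)) - cnj (fac k i * h (pt k i)) * fac k j)
        / (pt k j - cnj (pt k i)) = cnj (fac k i) * fac k j * nevanlinna_kernel h (pt k j) (pt k i)" for k
      by (simp add: nevanlinna_kernel_def algebra_simps diff_divide_distrib)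
    moreover have "A i j = (cnj (e i) * c j - cnj (c i) * e j) / (p j - cnj (p i))"
      by (simp only: A_def False if_False)
    ultimately show ?thesis by simp
  qed
  have A_herm: "hermitian N A"
  proof -
    have "A j i = cnj (A i j)" for i j
    proof (cases "i = j \<and> node i")
      case False
      then have F: "(i = j \<and> node i) = False" "(j = i \<and> node j) = False" by auto
      have "cnj (A i j) = (e i * cnj (c j) - c i * cnj (e j)) / (cnj (p j) - p i)"
        by (simp only: A_def F if_False complex_cnj_divide complex_cnj_diff complex_cnj_mult complex_cnj_cnj)
      also have "\<dots> = (- (cnj (e j) * c i - cnj (c j) * e i)) / (- (p i - cnj (p j)))"
        by (simp only: minus_diff_eq mult.commute)
      also have "\<dots> = A j i" by (simp only: minus_divide_divide A_def F if_False)
      finally show ?thesis ..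
    qed (auto simp: A_def)
    then show ?thesis unfolding hermitian_def by blast
  qed
  have "eventually (\<lambda>k. \<forall>i<N. pt k i \<in> analyticity_domain h) sequentially"
  proof -
    have "eventually (\<lambda>k. pt k i \<in> analyticity_domain h) sequentially" if "i < N" for i
      using that app[of i] z by (auto simp: pt_def node_def node_approx_def N_def)
    then have "eventually (\<lambda>k. \<forall>i\<in>{..<N}. pt k i \<in> analyticity_domain h) sequentially"
      by (intro eventually_ball_finite) auto
    then show ?thesis by eventually_elim auto
  qed
  then have "eventually (\<lambda>k. sq_neg (kernel_mat h N (pt k)) \<le> \<kappa>') sequentially"
    by eventually_elim (use bound[of N] z(1) in \<open>auto simp: N_def\<close>)
  then have sqA: "sq_neg (fun_mat N A) \<le> \<kappa>'"
    by (intro sq_neg_limit_kernel[OF A_herm A_lim])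
  have A_P: "A i j = P i j" if "node i" "node j" "i \<noteq> j" for i j
    using that P_offdiag[of i j] by (auto simp: A_def e_def c_def p_def node_def)
  show False
  proof (rule sq_neg_nonpositive_family[OF P_hermitian])
    fix I :: "nat set" and b :: "nat \<Rightarrow> nat \<Rightarrow> complex"
    assume I: "finite I"
      and big: "\<And>x. \<exists>i<n. x i \<noteq> 0 \<Longrightarrow> \<forall>i<n. mvec n P x i = 0 \<Longrightarrow> card I > sq_neg (fun_mat n P)"
      and fam: "\<And>a y. (\<And>i. i < n \<Longrightarrow> y i = (\<Sum>s\<in>I. b s i * a s)) \<Longrightarrow>
        Re (herm_form n P y y) \<le> 0 \<and>
        (Re (herm_form n P y y) = 0 \<longrightarrow> (\<forall>i<n. mvec n P y i = 0)) \<and>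
        ((\<exists>s\<in>I. a s \<noteq> 0) \<longrightarrow> (\<exists>i<n. y i \<noteq> 0))"
    define Y where "Y = (\<lambda>s i. if i < n then b s i else 0)"
    have "card I \<le> card E + sq_neg (fun_mat N A)"
    proof (rule card_le_sq_neg[OF A_herm, where Y = Y and b = "\<lambda>r s. b s r"])
      fix a y
      assume a: "\<exists>s\<in>I. a s \<noteq> 0" and aE: "\<forall>r\<in>E. (\<Sum>s\<in>I. b s r * a s) = 0"
        and y: "\<And>i. y i = (\<Sum>s\<in>I. Y s i * a s)"
      have yn: "y i = (\<Sum>s\<in>I. b s i * a s)" if "i < n" for i using that by (simp add: y Y_def)
      have y0: "y i = 0" if "\<not> node i" for i
        using that aE yn by (cases "i < n") (auto simp: node_def y Y_def)
      note famy = fam[OF yn]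
      have split: "mvec N A y k = mvec n A y k" for k
      proof -
        have "mvec N A y k = (\<Sum>j\<in>{..<n}. A k j * y j)"
          unfolding mvec_def by (rule sum.mono_neutral_right) (auto simp: N_def y0 node_def)
        then show ?thesis by (simp add: mvec_def)
      qed
      \<comment> \<open>On good nodes \<open>A\<close> agrees with \<open>P\<close> off the
        diagonal, so the two forms differ exactly by this nonnegative diagonal term.\<close>
      define defect where "defect = (\<Sum>i<n. (Re (P i i) - \<delta> i) * (cmod (y i))\<^sup>2)"
      have \<delta>le: "\<delta> i \<le> Re (P i i)" if "node i" for i
        using app[of i] that by (simp add: node_def node_approx_def)
      have defect: "defect \<ge> 0"
        unfolding defect_def
      proof (rule sum_nonneg)
        fix i
        show "(Re (P i i) - \<delta> i) * (cmod (y i))\<^sup>2 \<ge> 0"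
          using \<delta>le[of i] y0[of i] by (cases "node i") auto
      qed
      have row: "mvec n A y i = mvec n P y i - complex_of_real (Re (P i i) - \<delta> i) * y i" if i: "node i" for i
      proof -
        have "mvec n A y i = (\<Sum>j<n. P i j * y j - (if j = i then complex_of_real (Re (P i i) - \<delta> i) * y i else 0))"
          unfolding mvec_def
        proof (intro sum.cong refl)
          fix j assume "j \<in> {..<n}"
          show "A i j * y j = P i j * y j - (if j = i then complex_of_real (Re (P i i) - \<delta> i) * y i else 0)"
          proof (cases "node j")
            case True
            have "P i i = complex_of_real (Re (P i i))" by (simp add: P_def)
            then show ?thesis using i True A_P[of i j]
              by (cases "j = i") (auto simp: A_def algebra_simps)
          qed (use y0 i in auto)
        qed
        then show ?thesis using i by (simp add: sum_subtractf mvec_def node_def)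
      qed
      have "herm_form N A y y = (\<Sum>i<n. cnj (y i) * mvec n A y i)"
        unfolding herm_form_def split
        by (rule sum.mono_neutral_right) (auto simp: N_def y0 node_def)
      also have "\<dots> = (\<Sum>i<n. cnj (y i) * mvec n P y i
          - complex_of_real ((Re (P i i) - \<delta> i) * (cmod (y i))\<^sup>2))"
      proof (intro sum.cong refl)
        fix i
        show "cnj (y i) * mvec n A y i = cnj (y i) * mvec n P y i
          - complex_of_real ((Re (P i i) - \<delta> i) * (cmod (y i))\<^sup>2)"
        proof (cases "node i")
          case True
          then show ?thesis unfolding row[OF True] of_real_mult complex_norm_square
            by (simp add: algebra_simps)
        qed (simp add: y0)
      qed
      also have "\<dots> = herm_form n P y y - complex_of_real defect"
        by (simp add: herm_form_def sum_subtractf defect_def)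
      finally have form: "herm_form N A y y = herm_form n P y y - complex_of_real defect" .
      have "\<exists>i<N. mvec N A y i \<noteq> 0"
      proof (rule ccontr)
        assume "\<not> ?thesis"
        then have 0: "\<And>i. i < N \<Longrightarrow> mvec N A y i = 0" by auto
        then have "herm_form N A y y = 0" by (auto simp: herm_form_def)
        then have "Re (herm_form n P y y) = defect" by (simp add: form)
        then have "Re (herm_form n P y y) = 0" using famy defect by simp
        then have kery: "ker y" using famy by (simp add: ker_def)
        have ney: "\<exists>i<n. y i \<noteq> 0" using famy a by blast
        \<comment> \<open>The border rows of \<open>A\<close> yield the interpolation relation at
          the conjugate points. Conjugating \<open>y\<close>, which stays in the kernel because
          \<open>P\<close> is real, carries it back to the points \<open>z r\<close>.\<close>
        let ?u = "\<lambda>i. cnj (y i)"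
        have "num ?u (z r) = h (z r) * den ?u (z r)" if r: "r < m" for r
        proof -
          let ?\<zeta> = "cnj (z r)"
          have "(\<Sum>j<n. A (n + r) j * y j) = 0"
          proof -
            have "n + r < N" using r by (simp add: N_def)
            from 0[OF this] show ?thesis unfolding split by (simp only: mvec_def)
          qed
          moreover have "(\<Sum>j<n. A (n + r) j * y j)
              = (\<Sum>j<n. cnj (h (z r)) * (complex_of_real (nE j) * y j / (?\<zeta> - complex_of_real (x j)))
                - complex_of_real (nC j) * y j / (?\<zeta> - complex_of_real (x j)))"
          proof (intro sum.cong refl)
            fix j
            show "A (n + r) j * y j = cnj (h (z r)) * (complex_of_real (nE j) * y j / (?\<zeta> - complex_of_real (x j)))
                - complex_of_real (nC j) * y j / (?\<zeta> - complex_of_real (x j))"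
            proof (cases "node j")
              case True
              have "A (n + r) j = (complex_of_real (nC j) - cnj (h (z r)) * complex_of_real (nE j))
                  / (complex_of_real (x j) - ?\<zeta>)"
                using True by (auto simp: A_def node_def e_def c_def p_def)
              also have "\<dots> = (cnj (h (z r)) * complex_of_real (nE j) - complex_of_real (nC j))
                  / (?\<zeta> - complex_of_real (x j))"
                by (metis minus_diff_eq minus_divide_divide)
              finally show ?thesis by (simp add: left_diff_distrib diff_divide_distrib mult.assoc)
            qed (simp add: y0)
          qed
          ultimately have "cnj (h (z r)) * den y ?\<zeta> - num y ?\<zeta> = 0"
            by (simp add: den_def num_def sum_subtractf sum_distrib_left)
          then have "cnj (num y ?\<zeta>) = cnj (cnj (h (z r)) * den y ?\<zeta>)" by simp
          moreover have "cnj (num y ?\<zeta>) = num ?u (z r)" "cnj (den y ?\<zeta>) = den ?u (z r)"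
            by (simp_all add: num_def den_def)
          ultimately show ?thesis by simp
        qed
        then show False using contra ker_cnj[OF kery] ney by auto
      qed
      then show "Re (herm_form N A y y) \<le> 0 \<and> (\<exists>i<N. mvec N A y i \<noteq> 0)"
        using form famy defect by simp
    qed (use I E finite_subset in auto)
    then show False
      using big[OF sing(2)] sing(1) sqA card by (simp add: pick_index_eq ker_def)
  qed
qed

end

section \<open>Uniqueness of the solution\<close>

context pick_minimal
begin

lemma master_solution_unique:
  assumes h: "master_solution n l x w \<gamma> \<xi> h" and z0: "Im z0 > 0"
  shows "h z0 = sol z0"
proof -
  obtain \<kappa>' E where gen: "h \<in> gen_nevanlinna \<kappa>'" and E: "E \<subseteq> {..<n}"
    "card E + \<kappa>' = pick_index n l x w \<gamma> \<xi>"
    and int: "\<And>i. i \<in> {..<n} - E \<Longrightarrow> interpolates_at l x w \<gamma> \<xi> h i"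
    using h unfolding master_solution_def by force
  have mero: "h nicely_meromorphic_on {z. Im z > 0}" using gen by (simp add: gen_nevanlinna_def)
  have n0: "n > 0" using v_nonzero by auto
  \<comment> \<open>From \<open>n\<close> points of this set the previous lemma produces one kernel
    vector \<open>u\<close> serving all of them. Its denominator is nonzero at some point, where
    \<open>h\<close> equals the common quotient of all kernel vectors, namely \<open>sol\<close>; so
    the set is finite.\<close>
  let ?D = "{z \<in> analyticity_domain h. den v z \<noteq> 0 \<and> h z \<noteq> sol z}"
  have "finite ?D"
  proof (rule ccontr)
    assume "infinite ?D"
    from infinite_arbitrarily_large[OF this, of n]
    obtain Z where Z: "finite Z" "card Z = n" "Z \<subseteq> ?D" by (elim exE conjE)
    obtain z where z: "bij_betw z {..<n} Z"
      using ex_bij_betw_nat_finite[OF Z(1)] Z(2) by (auto simp: atLeast0LessThan)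
    have zD: "z r \<in> ?D" if "r < n" for r
      using bij_betwE[OF z] that Z(3) by blast
    obtain u where u: "ker u" "\<exists>i<n. u i \<noteq> 0" "\<forall>r<n. num u (z r) = h (z r) * den u (z r)"
      using solution_kernel_vector[OF gen E int ker_v v_nonzero n0, of z] zD by auto
    have off: "t \<noteq> complex_of_real (x j)" if "t \<in> ?D" for t j
      using that by (auto simp: analyticity_domain_def)
    have "\<exists>t\<in>Z. den u t \<noteq> 0"
      by (rule ker_den_nonzero[OF u(1,2) Z(1)]) (use Z off in auto)
    then obtain r where r: "r < n" "den u (z r) \<noteq> 0"
      using z by (auto simp: bij_betw_def)
    have "den u (z r) * num v (z r) = den v (z r) * num u (z r)"
      using off[OF zD[OF r(1)]] by (intro num_den_proportional u(1) ker_v)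
    then have "den u (z r) * num v (z r) = den u (z r) * (h (z r) * den v (z r))"
      using u(3) r(1) by (simp add: mult_ac)
    then have "num v (z r) = h (z r) * den v (z r)" using r(2) by simp
    then have "sol (z r) = h (z r)" using zD[OF r(1)] unfolding sol_def by simp
    then show False using zD[OF r(1)] by simp
  qed
  have "eventually (\<lambda>z. h analytic_on {z}) (at z0)"
    using meromorphic_on_imp_not_islimpt_singularities[of h "{z. Im z > 0}" z0] mero z0
    by (simp add: nicely_meromorphic_on_def islimpt_iff_eventually)
  moreover have "eventually (\<lambda>z. z \<in> {z. Im z > 0}) (at z0)"
    using z0 by (intro eventually_at_in_open') (auto simp: open_halfspace_Im_gt)
  moreover have "eventually (\<lambda>z. z \<notin> ?D) (at z0)"
    using islimpt_finite[OF \<open>finite ?D\<close>, of z0] by (auto simp: islimpt_iff_eventually)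
  ultimately have ev: "eventually (\<lambda>z. h z = sol z) (at z0)"
    using eventually_den_nonzero[of z0]
    by eventually_elim (auto simp: analyticity_domain_def)
  \<comment> \<open>Agreement on a punctured neighbourhood extends to \<open>z0\<close> because both
    functions are in normal form: they have a common pole with value 0 there, or equal
    limits.\<close>
  have H: "is_pole h z0 \<and> h z0 = 0 \<or> h \<midarrow>z0\<rightarrow> h z0"
    and S: "is_pole sol z0 \<and> sol z0 = 0 \<or> sol \<midarrow>z0\<rightarrow> sol z0"
    using mero sol_nicely_meromorphic z0 by (auto simp: nicely_meromorphic_on_def)
  have pole: "is_pole h z0 \<longleftrightarrow> is_pole sol z0" using is_pole_cong[OF ev refl] .
  have no_pole: "\<not> is_pole h z0" if "h \<midarrow>z0\<rightarrow> c" for c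
    using that not_tendsto_and_filterlim_at_infinity[OF at_neq_bot, of h c z0]
    by (auto simp: is_pole_def)
  show ?thesis
  proof (cases "is_pole h z0")
    case True
    then have "h z0 = 0" using H no_pole by blast
    moreover have "sol z0 = 0"
    proof (rule ccontr)
      assume "sol z0 \<noteq> 0"
      then have "sol \<midarrow>z0\<rightarrow> sol z0" using S by simp
      then have "h \<midarrow>z0\<rightarrow> sol z0" using tendsto_cong[OF ev] by simp
      with True no_pole show False by simp
    qed
    ultimately show ?thesis by simp
  next
    case False
    then have "h \<midarrow>z0\<rightarrow> h z0" "sol \<midarrow>z0\<rightarrow> sol z0" using H S pole by simp_all
    then have "h \<midarrow>z0\<rightarrow> h z0" "h \<midarrow>z0\<rightarrow> sol z0" using tendsto_cong[OF ev] by simp_all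
    then show ?thesis by (rule tendsto_unique[OF at_neq_bot])
  qed
qed

end

text \<open>Each index is attained by some kernel matrix and is therefore bounded by the other
  one.\<close>

lemma gen_nevanlinna_index_unique:
  assumes "f \<in> gen_nevanlinna a" "f \<in> gen_nevanlinna b"
  shows "a = b"
proof -
  have "c \<le> d" if "f \<in> gen_nevanlinna c" "f \<in> gen_nevanlinna d" for c d
    using that unfolding gen_nevanlinna_def by blast
  then show ?thesis using assms by (simp add: order_antisym)
qed

theorem theorem2p1:
  fixes n l :: nat and x w \<gamma> \<xi> :: "nat \<Rightarrow> real"
  assumes "interpolation_data n l x \<xi>"
    and "\<not> invertible_mat (pick_mat n l x w \<gamma> \<xi>)"
  shows "\<exists>f. master_solution n l x w \<gamma> \<xi> f \<and>
           (\<forall>g. master_solution n l x w \<gamma> \<xi> g \<longrightarrow> (\<forall>z\<in>\<complex>\<^sup>+. g z = f z)) \<and>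
           (f \<in> gen_nevanlinna (pick_index n l x w \<gamma> \<xi>) \<longrightarrow>
              boundary_interpolation_solution n l x w \<gamma> \<xi> f)"
proof -
  interpret pick_data n l x w \<gamma> \<xi> using assms(1) by unfold_locales
  show ?thesis
  proof (rule minimal_kernel_vector[OF assms(2)])
    fix v
    assume v: "ker v" "\<exists>i<n. v i \<noteq> 0" "\<And>i. i < n \<Longrightarrow> cnj (v i) = v i"
      "\<And>u. ker u \<Longrightarrow> (\<And>i. i < n \<Longrightarrow> v i = 0 \<Longrightarrow> u i = 0) \<Longrightarrow> \<exists>t. \<forall>i<n. u i = t * v i"
    interpret pick_minimal n l x w \<gamma> \<xi> v by unfold_locales (fact v)+
    have "boundary_interpolation_solution n l x w \<gamma> \<xi> sol"
      if gen: "sol \<in> gen_nevanlinna (pick_index n l x w \<gamma> \<xi>)"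
    proof -
      obtain \<kappa>' E where "sol \<in> gen_nevanlinna \<kappa>'" and E: "E \<subseteq> {..<n}"
        "card E = pick_index n l x w \<gamma> \<xi> - \<kappa>'"
        and int: "\<And>i. i \<in> {..<n} - E \<Longrightarrow> interpolates_at l x w \<gamma> \<xi> sol i"
        using sol_master unfolding master_solution_def by blast
      \<comment> \<open>Full index leaves no room for exceptional nodes, so the conditions hold at
        every node.\<close>
      then have "card E = 0" using gen_nevanlinna_index_unique gen by force
      moreover have "finite E" using E(1) by (rule finite_subset) simp
      ultimately have "E = {}" by simp
      then show ?thesis using gen int by (simp add: boundary_interpolation_solution_def)
    qed
    then show ?thesis using sol_master master_solution_unique by blast
  qed
qed

end
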